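(* Let $V$ be a reflexive Banach space which is a vector lattice induced by a closed convex cone $V_+$ with $V_+\cap(-V_+)=\{0\}$, and suppose that $v_n\to v$ in $V$ implies $\sup(0,v_n)\rightharpoonup\sup(0,v)$ in $V$. Let $f,d\in V^*$ and let $y\in\mathbf Q(f)$ satisfy: (a) there exists $\epsilon>0$ such that $\Phi\colon B_\epsilon(y)\to V$ is Lipschitz with Lipschitz constant $C_\Phi<C_a/(C_a+C_b)$; (b) $\Phi\colon V\to V$ is Hadamard directionally differentiable at $y$. Let $0<R\le\epsilon$. Then, for $s>0$ sufficiently small, there exist $y^s\in\mathbf Q(f+sd)\cap B_R(y)$ and an element $\alpha=\alpha(d)\in V$ (independent of $s$) such that $$y^s=y+s\alpha+o(s),$$ where $s^{-1}o(s)\to0$ in $V$ as $s\to0^+$, and $\alpha$ satisfies the quasi-variational inequality $$\alpha\in\mathcal K^y(\alpha):\quad\langle A\alpha-d,\,\alpha-v\rangle\le0\quad\forall v\in\mathcal K^y(\alpha),\qquad \mathcal K^y(\alpha):=\Phi'(y)(\alpha)+\mathcal T_{\mathbf K(y)}(y)\cap[f-Ay]^\perp .$$ The directional derivative $\alpha=\alpha(d)$ is positively homogeneous in $d$.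
   Context: $V$ is real with dual $V^*$ and pairing $\langle\cdot,\cdot\rangle$; the order is $u\le v$ iff $v-u\in V_+$, and $\inf(u,v),\sup(u,v)$ exist in $V$. With $u^+:=\sup(0,u)$, $u^-:=u^+-u$, $A\colon V\to V^*$ is linear and $C_a,C_b>0$ are constants with $\langle Au,v\rangle\le C_b\|u\|_V\|v\|_V$, $\langle Au,u\rangle\ge C_a\|u\|_V^2$, $\langle Au^+,u^-\rangle\le0$ for all $u,v\in V$. $\Phi\colon V\to V$ is a given map. $\mathbf K(w):=\{v\in V:v\le\Phi(w)\}$. $\mathbf Q(f)$ is the set of all $y\in V$ with $y\in\mathbf K(y)$ and $\langle Ay-f,y-v\rangle\le0$ for all $v\in\mathbf K(y)$. $B_r(u)$ is the closed ball in $V$ of radius $r$ centred at $u$. For $u\in\mathbf K(w)$ the radial cone is $\mathcal R_{\mathbf K(w)}(u):=\{h\in V:\exists s^*>0,\ u+sh\in\mathbf K(w)\ \forall s\in[0,s^*]\}$ and the tangent cone is its closure $\mathcal T_{\mathbf K(w)}(u):=\overline{\mathcal R_{\mathbf K(w)}(u)}$. $[g]^\perp:=\{v\in V:\langle g,v\rangle=0\}$ for $g\in V^*$. $\Phi$ is Hadamard directionally differentiable at $y$ if for every $h\in V$ there is $\Phi'(y)(h)\in V$ such that $s^{-1}(\Phi(y+sh_s)-\Phi(y))\to\Phi'(y)(h)$ in $V$ as $s\to0^+$ whenever $h_s\to h$ in $V$. *)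

theory Defs
  imports "HOL-Analysis.Analysis"
begin

text \<open>The topological dual of \<open>'a\<close> is the type \<open>'a \<Rightarrow>\<^sub>L real\<close>, so the
  pairing \<open>\<langle>g, v\<rangle>\<close> is \<open>blinfun_apply g v\<close>.\<close>

definition reflexive_space :: "'a::real_normed_vector itself \<Rightarrow> bool" where
  "reflexive_space _ \<longleftrightarrow>
    (\<forall>F :: ('a \<Rightarrow>\<^sub>L real) \<Rightarrow>\<^sub>L real. \<exists>v :: 'a. \<forall>g. blinfun_apply F g = blinfun_apply g v)"

definition weakly_tendsto :: "(nat \<Rightarrow> 'a::real_normed_vector) \<Rightarrow> 'a \<Rightarrow> bool" where
  "weakly_tendsto u v \<longleftrightarrow>
    (\<forall>g :: 'a \<Rightarrow>\<^sub>L real. (\<lambda>n. blinfun_apply g (u n)) \<longlonglongrightarrow> blinfun_apply g v)"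

definition annihilator :: "('a::real_normed_vector \<Rightarrow>\<^sub>L real) \<Rightarrow> 'a set" where
  "annihilator g = {v. blinfun_apply g v = 0}"

definition radial_cone :: "'a::real_vector set \<Rightarrow> 'a \<Rightarrow> 'a set" where
  "radial_cone K u = {h. \<exists>s'>0. \<forall>s\<in>{0..s'}. u + s *\<^sub>R h \<in> K}"

definition tangent_cone :: "'a::real_normed_vector set \<Rightarrow> 'a \<Rightarrow> 'a set" where
  "tangent_cone K u = closure (radial_cone K u)"

definition has_Hadamard_derivative ::
  "('a::real_normed_vector \<Rightarrow> 'b::real_normed_vector) \<Rightarrow> ('a \<Rightarrow> 'b) \<Rightarrow> 'a \<Rightarrow> bool" where
  "has_Hadamard_derivative F F' y \<longleftrightarrow>
    (\<forall>h k. (k \<longlongrightarrow> h) (at_right (0::real)) \<longrightarrow>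
      ((\<lambda>s. inverse s *\<^sub>R (F (y + s *\<^sub>R k s) - F y)) \<longlongrightarrow> F' h) (at_right 0))"

text \<open>Solution set of the quasi-variational inequality with moving constraint set \<open>K\<close>.\<close>

definition QVI ::
  "('a::real_normed_vector \<Rightarrow> ('a \<Rightarrow>\<^sub>L real)) \<Rightarrow> ('a \<Rightarrow> 'a set) \<Rightarrow> ('a \<Rightarrow>\<^sub>L real) \<Rightarrow> 'a set" where
  "QVI A K f = {y. y \<in> K y \<and> (\<forall>v\<in>K y. blinfun_apply (A y - f) (y - v) \<le> 0)}"

definition obstacle_set :: "('a \<Rightarrow> 'a::ord) \<Rightarrow> 'a \<Rightarrow> 'a set" where
  "obstacle_set \<Phi> w = {v. v \<le> \<Phi> w}"

text \<open>The set \<open>\<Phi>'(y)(\<alpha>) + T \<inter> [f - Ay]\<^sup>\<bottom>\<close>, with \<open>T\<close> the tangent cone of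
  \<open>obstacle_set \<Phi> y\<close> at \<open>y\<close> and \<open>\<Phi>'\<close> standing for the directional derivative of \<open>\<Phi>\<close> at \<open>y\<close>;
  the intersection is formed first, the sum is a translation.\<close>

definition critical_set ::
  "('a \<Rightarrow> ('a \<Rightarrow>\<^sub>L real)) \<Rightarrow> ('a \<Rightarrow> 'a::{real_normed_vector, ord}) \<Rightarrow> ('a \<Rightarrow> 'a) \<Rightarrow>
    ('a \<Rightarrow>\<^sub>L real) \<Rightarrow> 'a \<Rightarrow> 'a \<Rightarrow> 'a set" where
  "critical_set A \<Phi> \<Phi>' f y \<alpha> =
    (\<lambda>h. \<Phi>' \<alpha> + h) ` (tangent_cone (obstacle_set \<Phi> y) y \<inter> annihilator (f - A y))"

end

theory Submission
  imports Defs
begin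

text \<open>
  With \<open>P(g)\<close> the solution over the cone \<open>V\<^sub>+\<close> of \<open>\<langle>Au - g, u - w\<rangle> \<le> 0\<close>, the substitution
  \<open>u = \<Phi>(y) - y\<close> identifies \<open>\<^bold>Q(f)\<close> with the fixed points of \<open>w \<mapsto> \<Phi>(w) - P(A\<Phi>(w) - f)\<close>. As \<open>P\<close> is
  \<open>1/C\<^sub>a\<close>-Lipschitz, this map is a contraction near \<open>y\<close>. The map \<open>P\<close> is directionally
  differentiable because \<open>V\<^sub>+\<close> is polyhedric, so \<open>\<alpha>\<close> is obtained as the fixed point of the
  linearized map; inserting \<open>y + s\<alpha>\<close> into the contraction leaves an \<open>o(s)\<close> defect.

  Coercivity makes \<open>V\<close> hilbertizable, so weak compactness is replaced by explicit Hilbert space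
  arguments: nested bounded closed convex sets intersect by the parallelogram identity, which
  yields minimizers, and approximate multipliers for \<open>T \<inter> [\<lambda>]\<^sup>\<bottom>\<close>.
\<close>

section \<open>Variational inequalities for coercive forms\<close>

text \<open>The functional \<open>g\<close> is a plain function, so that expressions such as
  \<open>a x\<close> or a shifted functional can serve as data directly.\<close>

definition VI :: "('a::real_normed_vector \<Rightarrow> 'a \<Rightarrow> real) \<Rightarrow> 'a set \<Rightarrow> ('a \<Rightarrow> real) \<Rightarrow> 'a set" where
  "VI a K g = {u \<in> K. \<forall>v\<in>K. a u (u - v) \<le> g (u - v)}"

text \<open>The form may be nonsymmetric; its diagonal is equivalent to the squared norm, so its
  symmetric part is a Hilbert inner product on the Banach space.\<close>

locale coercive_form = bounded_bilinear a for a :: "'a::banach \<Rightarrow> 'a \<Rightarrow> real" +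
  fixes c :: real
  assumes c_pos: "c > 0"
    and coercive: "a v v \<ge> c * (norm v)\<^sup>2"
begin

lemma form_nonneg: "a v v \<ge> 0"
  using coercive[of v] c_pos by (smt (verit) mult_nonneg_nonneg zero_le_power2)

text \<open>Strong convexity in exact form; \<open>t = 1/2\<close> is the parallelogram identity. It
  holds for nonsymmetric \<open>a\<close> too, since \<open>a v w\<close> and \<open>a w v\<close>
  enter both sides with the same coefficient.\<close>

lemma form_convex_combination:
  "a ((1 - t) *\<^sub>R v + t *\<^sub>R w) ((1 - t) *\<^sub>R v + t *\<^sub>R w) =
    (1 - t) * a v v + t * a w w - t * (1 - t) * a (v - w) (v - w)"
  by (simp add: add_left add_right diff_left diff_right scaleR_left scaleR_right) algebra

text \<open>The infima \<open>m n\<close> of the energy over \<open>W n\<close> increase and stay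
  bounded, so near-minimizers \<open>v n\<close> form a Cauchy sequence; closedness puts its limit
  into every \<open>W n\<close>.\<close>

lemma nested_convex_sets_Inter:
  fixes W :: "nat \<Rightarrow> 'a set"
  assumes closed: "\<And>n. closed (W n)" and cvx: "\<And>n. convex (W n)" and ne: "\<And>n. W n \<noteq> {}"
    and dec: "decseq W" and bdd: "bounded (W 0)"
  shows "\<exists>u. \<forall>n. u \<in> W n"
proof -
  define q where "q v = a v v" for v
  define m where "m n = Inf (q ` W n)" for n
  have sub: "W k \<subseteq> W n" if "n \<le> k" for n k
    using dec that by (auto simp: decseq_def)
  have below: "bdd_below (q ` W n)" for n
    using form_nonneg by (auto simp: q_def intro!: bdd_belowI2[where m = 0])
  have m_le: "m n \<le> q v" if "v \<in> W n" for n v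
    unfolding m_def using below that by (auto intro: cInf_lower)
  have m_mono: "incseq m"
    unfolding m_def incseq_def by (intro allI impI cInf_superset_mono image_mono below sub) (use ne in auto)
  obtain B where B: "\<And>v. v \<in> W 0 \<Longrightarrow> norm v \<le> B" using bdd by (auto simp: bounded_iff)
  obtain M where M: "M > 0" "\<And>u v. norm (a u v) \<le> norm u * norm v * M"
    using pos_bounded by blast
  have m_bdd: "m n \<le> B * B * M" for n
  proof -
    obtain v where v: "v \<in> W n" using ne by blast
    then have nv: "norm v \<le> B" using B sub[of 0 n] by auto
    have "q v \<le> norm v * norm v * M" using M(2)[of v v] by (simp add: q_def)
    also have "\<dots> \<le> B * B * M" using nv M(1) by (intro mult_right_mono mult_mono) (auto intro: order_trans[OF norm_ge_zero])
    finally show ?thesis using m_le[OF v] by linarith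
  qed
  have "convergent m"
    using incseq_convergent[OF m_mono, of "B * B * M"] m_bdd by (meson convergentI)
  then have mC: "Cauchy m" by (rule convergent_Cauchy)
  have "\<exists>v \<in> W n. q v < m n + inverse (Suc n)" for n
  proof -
    have "\<exists>x\<in>q ` W n. x < m n + inverse (real (Suc n))" unfolding m_def
      by (rule cInf_lessD) (use ne in auto)
    then show ?thesis by auto
  qed
  then obtain v where vW: "\<And>n. v n \<in> W n" and vq: "\<And>n. q (v n) < m n + inverse (Suc n)" by metis
  \<comment> \<open>For \<open>n \<le> k\<close> the midpoint of \<open>v n\<close> and
    \<open>v k\<close> lies in \<open>W n\<close>, so its energy is at least \<open>m n\<close>; the
    convexity identity turns this into a bound for the distance.\<close>
  have est: "c / 4 * (norm (v n - v k))\<^sup>2 \<le> \<bar>m k - m n\<bar> / 2 + inverse (Suc n)" if "n \<le> k" for n k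
  proof -
    have "v k \<in> W n" using vW sub that by blast
    then have "(1 - 1/2) *\<^sub>R v n + (1/2) *\<^sub>R v k \<in> W n"
      using cvx vW by (intro convexD) auto
    from m_le[OF this] have "m n \<le> 1/2 * q (v n) + 1/2 * q (v k) - 1/4 * a (v n - v k) (v n - v k)"
      unfolding q_def form_convex_combination by simp
    moreover have "inverse (real (Suc k)) \<le> inverse (real (Suc n))" using that by simp
    ultimately show ?thesis using vq[of n] vq[of k] coercive[of "v n - v k"] by argo
  qed
  have "Cauchy v"
  proof (rule metric_CauchyI)
    fix e :: real assume e: "e > 0"
    define d where "d = c / 4 * e\<^sup>2"
    have d: "d > 0" using e c_pos by (simp add: d_def)
    obtain N1 where N1: "\<And>n k. n \<ge> N1 \<Longrightarrow> k \<ge> N1 \<Longrightarrow> \<bar>m k - m n\<bar> < d"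
      using mC d unfolding Cauchy_def dist_real_def by metis
    obtain N2 where N2: "inverse (real (Suc N2)) < d / 2" using d reals_Archimedean[of "d/2"] by auto
    have half: "x / 2 + y < d" if "y \<le> z" "x < d" "z < d / 2" for x y z :: real using that by linarith
    have "norm (v n - v k) < e" if "n \<ge> max N1 N2" "n \<le> k" for n k
    proof -
      have "inverse (real (Suc n)) \<le> inverse (real (Suc N2))" using that by simp
      moreover have "\<bar>m k - m n\<bar> < d" using N1 that by auto
      ultimately have "\<bar>m k - m n\<bar> / 2 + inverse (real (Suc n)) < d" using N2 by (intro half)
      then have "c / 4 * (norm (v n - v k))\<^sup>2 < c / 4 * e\<^sup>2"
        using est[OF that(2)] unfolding d_def by (rule le_less_trans[rotated])
      then have "(norm (v n - v k))\<^sup>2 < e\<^sup>2" using c_pos by simp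
      then show ?thesis using e by (simp add: power2_less_imp_less)
    qed
    then have "dist (v n) (v k) < e" if "n \<ge> max N1 N2" "k \<ge> max N1 N2" for n k
      using that by (metis dist_commute dist_norm nle_le)
    then show "\<exists>M. \<forall>n\<ge>M. \<forall>k\<ge>M. dist (v n) (v k) < e" by blast
  qed
  then obtain u where u: "v \<longlonglongrightarrow> u" using Cauchy_convergent_iff convergent_def by blast
  have "u \<in> W n" for n
  proof (rule Lim_in_closed_set[OF closed _ _ u])
    show "\<forall>\<^sub>F k in sequentially. v k \<in> W n"
      using eventually_ge_at_top[of n] by eventually_elim (use vW sub in blast)
  qed simp
  then show ?thesis by blast
qed

text \<open>The sublevel sets of \<open>J\<close> slightly above its infimum are closed, convex,
  decreasing and, by coercivity, bounded. A common point attains the infimum.\<close>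

lemma quadratic_minimizer:
  assumes K: "closed K" "convex K" "K \<noteq> {}" and g: "bounded_linear g"
  shows "\<exists>u\<in>K. \<forall>v\<in>K. a u u / 2 - g u \<le> a v v / 2 - g v"
proof -
  interpret g: bounded_linear g by (rule g)
  define J where "J v = a v v / 2 - g v" for v
  obtain G where G: "G > 0" "\<And>v. norm (g v) \<le> norm v * G" using g.pos_bounded by blast
  \<comment> \<open>Completing the square: half of the coercive term absorbs the linear term at the
    price of the constant \<open>G\<^sup>2 / c\<close>.\<close>
  have J_low: "J v \<ge> c / 4 * (norm v)\<^sup>2 - G\<^sup>2 / c" for v
  proof -
    have "0 \<le> (c * norm v / 2 - G)\<^sup>2 / c" using c_pos by simp
    also have "\<dots> = c / 4 * (norm v)\<^sup>2 - G * norm v + G\<^sup>2 / c" using c_pos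
      by (simp add: field_simps power2_eq_square)
    finally show ?thesis using coercive[of v] G(2)[of v] by (simp add: J_def mult.commute)
  qed
  have below: "bdd_below (J ` K)"
  proof (rule bdd_belowI2)
    show "- (G\<^sup>2 / c) \<le> J v" for v
    proof -
      have "0 \<le> c / 4 * (norm v)\<^sup>2" using c_pos by simp
      then show ?thesis using J_low[of v] by linarith
    qed
  qed
  define m where "m = Inf (J ` K)"
  define W where "W n = {v \<in> K. J v \<le> m + inverse (real (Suc n))}" for n
  have cont: "continuous_on UNIV J" unfolding J_def
    by (intro continuous_on_diff continuous_on_divide continuous_on g.continuous_on continuous_on_id continuous_on_const) simp_all
  have J_convex: "J ((1 - t) *\<^sub>R v + t *\<^sub>R w) \<le> (1 - t) * J v + t * J w" if "0 \<le> t" "t \<le> 1" for t v w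
  proof -
    have "0 \<le> t * (1 - t) * a (v - w) (v - w)" using that form_nonneg by simp
    moreover have "g ((1 - t) *\<^sub>R v + t *\<^sub>R w) = (1 - t) * g v + t * g w"
      by (simp only: g.add g.scaleR real_scaleR_def)
    ultimately show ?thesis unfolding J_def form_convex_combination by (simp add: field_simps)
  qed
  have "\<exists>u. \<forall>n. u \<in> W n"
  proof (rule nested_convex_sets_Inter)
    show "closed (W n)" for n
    proof -
      have "W n = K \<inter> {v. J v \<le> m + inverse (real (Suc n))}" by (auto simp: W_def)
      moreover have "closed {v. J v \<le> m + inverse (real (Suc n))}"
        using cont by (intro closed_Collect_le) auto
      ultimately show ?thesis using K by auto
    qed
    show "convex (W n)" for n
    proof (rule convexI)
      fix v w and s t :: real assume vw: "v \<in> W n" "w \<in> W n" and st: "0 \<le> s" "0 \<le> t" "s + t = 1"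
      have s: "s = 1 - t" using st by simp
      have "J (s *\<^sub>R v + t *\<^sub>R w) \<le> (1 - t) * J v + t * J w" unfolding s using st by (intro J_convex) auto
      also have "\<dots> \<le> (1 - t) * (m + inverse (real (Suc n))) + t * (m + inverse (real (Suc n)))"
        using vw st by (intro add_mono mult_left_mono) (auto simp: W_def)
      also have "\<dots> = m + inverse (real (Suc n))" by (simp add: algebra_simps)
      finally show "s *\<^sub>R v + t *\<^sub>R w \<in> W n" using K vw st by (auto simp: W_def intro: convexD)
    qed
    show "W n \<noteq> {}" for n
    proof -
      have "\<exists>x\<in>J ` K. x < m + inverse (real (Suc n))" unfolding m_def
        by (rule cInf_lessD) (use K in auto)
      then show ?thesis by (auto simp: W_def intro: less_imp_le)
    qed
    show "decseq W"
    proof (rule decseq_SucI, rule subsetI)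
      fix n v assume v: "v \<in> W (Suc n)"
      have "inverse (real (Suc (Suc n))) \<le> inverse (real (Suc n))" by (rule le_imp_inverse_le) simp_all
      moreover have "v \<in> K" "J v \<le> m + inverse (real (Suc (Suc n)))" using v by (simp_all add: W_def)
      ultimately have "v \<in> K" "J v \<le> m + inverse (real (Suc n))" by linarith+
      then show "v \<in> W n" unfolding W_def by blast
    qed
    have nb: "norm v \<le> max 1 (4 / c * (m + 1 + G\<^sup>2 / c))" if "v \<in> W 0" for v
    proof (cases "norm v \<le> 1")
      case False
      have "norm v \<le> (norm v)\<^sup>2" using False by (intro self_le_power) auto
      moreover have "c / 4 * (norm v)\<^sup>2 \<le> m + 1 + G\<^sup>2 / c" using J_low[of v] that by (simp add: W_def)
      then have "(norm v)\<^sup>2 \<le> 4 / c * (m + 1 + G\<^sup>2 / c)" using c_pos by (simp add: field_simps)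
      ultimately show ?thesis by linarith
    qed simp
    then show "bounded (W 0)" by (auto simp: bounded_iff)
  qed
  then obtain u where u: "\<And>n. u \<in> W n" by blast
  have "J u \<le> m"
  proof (rule field_le_epsilon)
    fix e :: real assume "e > 0"
    then obtain n where "inverse (real (Suc n)) < e" using reals_Archimedean by blast
    then show "J u \<le> m + e" using u[of n] by (simp add: W_def)
  qed
  moreover have "m \<le> J v" if "v \<in> K" for v unfolding m_def using below that by (auto intro: cInf_lower)
  moreover have "u \<in> K" using u[of 0] by (simp add: W_def)
  ultimately show ?thesis unfolding J_def by (meson order_trans)
qed

text \<open>The quadratic functional only sees the symmetric part of \<open>a\<close>, so the
  first-order condition at its minimizer is the variational inequality of that part.\<close>

lemma VI_symmetrized_exists:
  assumes K: "closed K" "convex K" "K \<noteq> {}" and g: "bounded_linear g"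
  shows "VI (\<lambda>u v. (a u v + a v u) / 2) K g \<noteq> {}"
proof -
  interpret g: bounded_linear g by (rule g)
  obtain u where u: "u \<in> K" and min: "\<And>v. v \<in> K \<Longrightarrow> a u u / 2 - g u \<le> a v v / 2 - g v"
    using quadratic_minimizer[OF assms] by blast
  have "(a u (u - v) + a (u - v) u) / 2 \<le> g (u - v)" if v: "v \<in> K" for v
  proof -
    define w where "w = u - v"
    \<comment> \<open>Comparing \<open>u\<close> with the point \<open>u - t *\<^sub>R w\<close> on
      the segment to \<open>v\<close> and dividing by \<open>t\<close> leaves a remainder of order
      \<open>t\<close>, removed by the limit below.\<close>
    have *: "(a u w + a w u) / 2 - g w \<le> t * a w w / 2" if t: "0 < t" "t \<le> 1" for t
    proof -
      have "(1 - t) *\<^sub>R u + t *\<^sub>R v \<in> K" using K u v t by (intro convexD) auto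
      moreover have "(1 - t) *\<^sub>R u + t *\<^sub>R v = u - t *\<^sub>R w" by (simp add: w_def algebra_simps)
      ultimately have "u - t *\<^sub>R w \<in> K" by simp
      from min[OF this] have "t * ((a u w + a w u) / 2 - g w) \<le> t * (t * a w w / 2)"
        by (simp add: diff_left diff_right scaleR_left scaleR_right g.diff g.scaleR field_simps)
      then show ?thesis using t by simp
    qed
    have lim: "((\<lambda>t. t * a w w / 2) \<longlongrightarrow> 0) (at_right (0::real))"
      by (auto intro!: tendsto_eq_intros)
    have "(a u w + a w u) / 2 - g w \<le> 0"
    proof (rule tendsto_lowerbound[OF lim])
      have "\<forall>\<^sub>F t in at_right (0::real). 0 < t \<and> t < 1"
        using eventually_at_right_less[of "0::real"] eventually_at_right_real[OF zero_less_one]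
        by eventually_elim simp_all
      then show "\<forall>\<^sub>F t in at_right 0. (a u w + a w u) / 2 - g w \<le> t * a w w / 2"
        by eventually_elim (use * in auto)
    qed simp
    then show ?thesis by (simp add: w_def)
  qed
  then have "u \<in> VI (\<lambda>u v. (a u v + a v u) / 2) K g" using u by (simp add: VI_def)
  then show ?thesis by blast
qed

text \<open>Each inequality is tested with the other solution; the sum bounds the form at
  \<open>u - u'\<close> from above by the difference of the data, and coercivity bounds it from
  below.\<close>

lemma VI_lipschitz:
  assumes u: "u \<in> VI a K g" "u' \<in> VI a K g'"
    and g: "linear g" "linear g'" and d: "\<And>v. g v - g' v \<le> D * norm v" and D: "D \<ge> 0"
  shows "norm (u - u') \<le> D / c"
proof -
  have "a u (u - u') \<le> g (u - u')" "a u' (u' - u) \<le> g' (u' - u)"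
    using u by (auto simp: VI_def)
  moreover have "a u' (u' - u) = - a u' (u - u')" "g' (u' - u) = - g' (u - u')"
    using g by (simp_all add: diff_right linear_diff)
  ultimately have "a (u - u') (u - u') \<le> g (u - u') - g' (u - u')" by (simp add: diff_left)
  then have "c * (norm (u - u'))\<^sup>2 \<le> D * norm (u - u')"
    using d[of "u - u'"] coercive[of "u - u'"] by linarith
  then have "norm (u - u') * (c * norm (u - u')) \<le> norm (u - u') * D"
    by (simp add: power2_eq_square mult_ac)
  then have "u = u' \<or> c * norm (u - u') \<le> D" by (smt (verit) mult_less_cancel_left norm_ge_zero norm_eq_zero eq_iff_diff_eq_0)
  then show ?thesis using c_pos D by (auto simp: field_simps)
qed

lemma VI_unique:
  assumes "u \<in> VI a K g" "u' \<in> VI a K g" "linear g"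
  shows "u = u'"
  using VI_lipschitz[OF assms(1,2,3,3), of 0] by simp

text \<open>Continuity method: passing from the symmetric part to \<open>a\<close> along \<open>a\<^sub>s + (n/N) k\<close>, with \<open>k\<close> the
  skew part, does not change the coercivity constant, so each step is a contraction.\<close>

lemma VI_exists:
  fixes K :: "'a set"
  assumes K: "closed K" "convex K" "K \<noteq> {}" and g: "bounded_linear g"
  shows "VI a K g \<noteq> {}"
proof -
  define k where "k u v = (a u v - a v u) / 2" for u v
  define b where "b t u v = (a u v + a v u) / 2 + t * k u v" for t u v
  have k_self: "k v v = 0" for v by (simp add: k_def)
  obtain M where M: "M > 0" "\<And>u v. norm (a u v) \<le> norm u * norm v * M" using pos_bounded by blast
  have k_bound: "\<bar>k u v\<bar> \<le> norm u * norm v * M" for u v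
    using M(2)[of u v] M(2)[of v u] by (simp add: k_def mult.commute[of "norm v"])
  have k: "bounded_bilinear k"
  proof
    show "k (u + u') v = k u v + k u' v" "k v (u + u') = k v u + k v u'" for u u' v
      by (simp_all add: k_def add_left add_right add_divide_distrib diff_divide_distrib)
    show "k (r *\<^sub>R u) v = r *\<^sub>R k u v" "k u (r *\<^sub>R v) = r *\<^sub>R k u v" for r u v
      by (simp_all add: k_def scaleR_left scaleR_right algebra_simps)
    show "\<exists>M. \<forall>u v. norm (k u v) \<le> norm u * norm v * M" using k_bound by auto
  qed
  interpret k: bounded_bilinear k by (rule k)
  have b: "coercive_form (b t) c" for t
  proof
    show "b t (u + u') v = b t u v + b t u' v" "b t v (u + u') = b t v u + b t v u'" for u u' v
      by (simp_all add: b_def add_left add_right k.add_left k.add_right add_divide_distrib distrib_left)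
    show "b t (r *\<^sub>R u) v = r *\<^sub>R b t u v" "b t u (r *\<^sub>R v) = r *\<^sub>R b t u v" for r u v
      by (simp_all add: b_def scaleR_left scaleR_right k.scaleR_left k.scaleR_right algebra_simps)
    have "norm (b t u v) \<le> norm u * norm v * (M + \<bar>t\<bar> * M)" for u v
    proof -
      have "\<bar>t\<bar> * \<bar>k u v\<bar> \<le> \<bar>t\<bar> * (norm u * norm v * M)" using k_bound by (intro mult_left_mono) auto
      moreover have "\<bar>b t u v\<bar> \<le> \<bar>a u v\<bar> / 2 + \<bar>a v u\<bar> / 2 + \<bar>t\<bar> * \<bar>k u v\<bar>"
        unfolding b_def abs_mult[symmetric] by (simp add: abs_if add_divide_distrib)
      ultimately show ?thesis using M(2)[of u v] M(2)[of v u]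
        by (simp add: mult.commute[of "norm v"] algebra_simps)
    qed
    then show "\<exists>M. \<forall>u v. norm (b t u v) \<le> norm u * norm v * M" by blast
    show "c > 0" "b t v v \<ge> c * (norm v)\<^sup>2" for v
      using c_pos coercive by (simp_all add: b_def k_self)
  qed
  \<comment> \<open>Each increment \<open>k / N\<close> is bounded by
    \<open>M / N \<le> c / 2\<close>; as solutions depend on the data with Lipschitz constant
    \<open>1 / c\<close>, the contraction factor becomes \<open>1/2\<close>.\<close>
  obtain N where N: "N > 0" "2 * M / c < real N"
    by (metis reals_Archimedean2 gr_zeroI less_trans of_nat_0 of_nat_0_less_iff not_less_iff_gr_or_eq zero_less_numeral mult_pos_pos divide_pos_pos M(1) c_pos)
  have N': "M / N \<le> c / 2" using N c_pos by (simp add: field_simps)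
  have "\<forall>g. bounded_linear g \<longrightarrow> VI (b (real n / real N)) K g \<noteq> {}" for n
  proof (induction n)
    case 0
    show ?case using VI_symmetrized_exists[OF K] by (simp add: b_def)
  next
    case (Suc n)
    let ?t = "real n / real N"
    interpret b: coercive_form "b ?t" c by (rule b)
    show ?case
    proof (intro allI impI)
      fix g :: "'a \<Rightarrow> real" assume g: "bounded_linear g"
      \<comment> \<open>The increment of the skew part moves to the right-hand side with its first
        argument frozen at \<open>w\<close>; a fixed point of the resulting solution map solves the
        problem for \<open>Suc n\<close>.\<close>
      define G where "G w v = g v - k w v / N" for w v
      have G: "bounded_linear (G w)" for w
        unfolding G_def using g
        by (intro bounded_linear_sub bounded_linear_divide[THEN bounded_linear_compose] k.bounded_linear_right)
      then have G_lin: "linear (G w)" for w by (rule bounded_linear.linear)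
      define S where "S w = (SOME u. u \<in> VI (b ?t) K (G w))" for w
      have S: "S w \<in> VI (b ?t) K (G w)" for w
        unfolding S_def using Suc.IH G[of w] by (metis all_not_in_conv someI_ex)
      have contr: "dist (S w) (S w') \<le> 1/2 * dist w w'" for w w'
      proof -
        have "norm (S w - S w') \<le> (norm (w - w') * (M / N)) / c"
        proof (rule b.VI_lipschitz[OF S S G_lin G_lin])
          fix v
          have "G w v - G w' v = k (w' - w) v / N" by (simp add: G_def k.diff_left diff_divide_distrib)
          also have "\<dots> \<le> (norm (w' - w) * norm v * M) / N"
            using k_bound[of "w' - w" v] by (intro divide_right_mono) auto
          finally show "G w v - G w' v \<le> norm (w - w') * (M / N) * norm v"
            by (simp add: norm_minus_commute mult_ac)
        qed (use M in auto)
        also have "\<dots> \<le> (norm (w - w') * (c / 2)) / c"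
          using N' c_pos by (intro divide_right_mono mult_left_mono) auto
        finally show ?thesis using c_pos by (simp add: dist_norm)
      qed
      obtain u where u: "S u = u"
        using banach_fix_type[of "1/2" S] contr by auto
      have "u \<in> VI (b (real (Suc n) / real N)) K g"
        using S[of u] unfolding u
        by (auto simp: VI_def b_def G_def add_divide_distrib algebra_simps)
      then show "VI (b (real (Suc n) / real N)) K g \<noteq> {}" by blast
    qed
  qed
  from this[of N] have "VI (b 1) K g \<noteq> {}" using N g by simp
  moreover have "b 1 = a" by (simp add: b_def k_def fun_eq_iff field_simps)
  ultimately show ?thesis by simp
qed

text \<open>A form of Mazur's theorem. The point \<open>p\<close> is the projection of
  \<open>x\<close> onto the closure with respect to \<open>a\<close>; passing to the weak limit in
  the functional \<open>a (p - x)\<close> forces \<open>p = x\<close>.\<close>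

lemma weak_limit_in_closure:
  fixes v :: "nat \<Rightarrow> 'a"
  assumes C: "convex C" and v: "\<And>n. v n \<in> C" and w: "weakly_tendsto v x"
  shows "x \<in> closure C"
proof -
  have "VI a (closure C) (a x) \<noteq> {}"
    using C v[of 0] closure_subset[of C]
    by (intro VI_exists bounded_linear_right closed_closure convex_closure) auto
  then obtain p where p: "p \<in> closure C" "\<And>w. w \<in> closure C \<Longrightarrow> a p (p - w) \<le> a x (p - w)"
    by (auto simp: VI_def)
  define G where "G = Blinfun (a (p - x))"
  have G: "blinfun_apply G w = a (p - x) w" for w
    by (simp add: G_def bounded_linear_Blinfun_apply bounded_linear_right)
  have "(\<lambda>n. blinfun_apply G (v n)) \<longlonglongrightarrow> blinfun_apply G x" using w by (simp add: weakly_tendsto_def)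
  then have "(\<lambda>n. a (p - x) (p - v n)) \<longlonglongrightarrow> a (p - x) (p - x)"
    unfolding G by (auto simp: diff_right intro!: tendsto_intros)
  moreover have "a (p - x) (p - v n) \<le> 0" for n
    using p(2)[of "v n"] v closure_subset[of C] by (auto simp: diff_left)
  ultimately have "a (p - x) (p - x) \<le> 0" by (intro tendsto_upperbound[where F = sequentially]) auto
  then have "c * (norm (p - x))\<^sup>2 \<le> 0" using coercive[of "p - x"] by linarith
  then have "p = x" using c_pos by (simp add: mult_le_0_iff)
  then show ?thesis using p by simp
qed

text \<open>If there is no such \<open>r\<close>, normalizing violating \<open>v\<close> by \<open>m v = -1\<close> gives nested bounded sets, and a
  common point has \<open>l v = 0\<close> and \<open>m v \<le> -1\<close>.\<close>

lemma approximate_multiplier: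
  fixes T :: "'a set"
  assumes T: "closed T" "convex T" "cone T"
    and l: "bounded_linear l" "\<And>v. v \<in> T \<Longrightarrow> l v \<ge> 0"
    and m: "bounded_linear m" "\<And>v. v \<in> T \<Longrightarrow> l v = 0 \<Longrightarrow> m v \<ge> 0"
    and e: "e > 0"
  shows "\<exists>r\<ge>0. \<forall>v\<in>T. m v + r * l v \<ge> - e * norm v"
proof (rule ccontr)
  interpret l: bounded_linear l by (rule l)
  interpret m: bounded_linear m by (rule m)
  assume "\<not> ?thesis"
  then have bad: "\<And>r. r \<ge> 0 \<Longrightarrow> \<exists>v\<in>T. m v + r * l v < - e * norm v" by (meson not_le)
  \<comment> \<open>The radius \<open>1 / e\<close> comes from the violated inequality after
    scaling; the bound on \<open>real n * l v\<close> for all \<open>n\<close> forces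
    \<open>l\<close> to vanish at a common point.\<close>
  define W where "W n = T \<inter> {v. m v \<le> -1} \<inter> {v. real n * l v \<le> 1} \<inter> cball 0 (1 / e)" for n :: nat
  have W_iff: "v \<in> W n \<longleftrightarrow> v \<in> T \<and> m v \<le> -1 \<and> real n * l v \<le> 1 \<and> norm v \<le> 1 / e" for v n
    by (auto simp: W_def)
  have "\<exists>u. \<forall>n. u \<in> W n"
  proof (rule nested_convex_sets_Inter)
    show "closed (W n)" for n
      unfolding W_def using T
      by (intro closed_Int closed_Collect_le closed_cball continuous_on_const continuous_on_mult
          l.continuous_on m.continuous_on continuous_on_id)
    show "convex (W n)" for n
    proof (rule convexI)
      fix v w and s t :: real assume vw: "v \<in> W n" "w \<in> W n" and st: "0 \<le> s" "0 \<le> t" "s + t = 1"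
      have 1: "s *\<^sub>R v + t *\<^sub>R w \<in> T" using T vw st by (intro convexD) (auto simp: W_iff)
      have 2: "norm (s *\<^sub>R v + t *\<^sub>R w) \<le> 1 / e"
        using convexD[OF convex_cball[of 0 "1/e"] _ _ st, of v w] vw by (auto simp: W_iff)
      have "s * m v + t * m w \<le> -1" "s * (real n * l v) + t * (real n * l w) \<le> 1"
        by (rule convex_bound_le[OF _ _ st]; use vw in \<open>simp add: W_iff\<close>)+
      then show "s *\<^sub>R v + t *\<^sub>R w \<in> W n" unfolding W_iff using 1 2
        by (simp add: l.add m.add l.scaleR m.scaleR algebra_simps)
    qed
    show "W n \<noteq> {}" for n
    proof -
      obtain v where v: "v \<in> T" "m v + real n * l v < - e * norm v" using bad[of "real n"] by auto
      have nl: "real n * l v \<ge> 0" using l(2) v by simp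
      have en: "e * norm v \<ge> 0" using e by simp
      then have mv: "m v < 0" using nl v by linarith
      define w where "w = inverse (- m v) *\<^sub>R v"
      have "w \<in> T" unfolding w_def using T(3) v mv by (intro mem_cone) auto
      moreover have "m w = -1" using mv by (simp add: w_def m.scaleR m.neg)
      moreover have "real n * l w \<le> 1" using mv v nl en
        by (simp add: w_def l.scaleR l.neg field_simps)
      moreover have "norm w \<le> 1 / e"
      proof -
        have "norm w = norm v / (- m v)"
          using mv by (simp add: w_def divide_inverse mult.commute)
        moreover have "norm v \<le> 1 / e * (- m v)" using v(2) nl e by (simp add: field_simps)
        ultimately show ?thesis using mv by (simp only: pos_divide_le_eq neg_0_less_iff_less)
      qed
      ultimately have "w \<in> W n" by (simp add: W_iff)
      then show ?thesis by blast
    qed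
    show "decseq W"
    proof (rule decseq_SucI, rule subsetI)
      fix n v assume "v \<in> W (Suc n)"
      moreover from this have "l v \<ge> 0" using l(2) by (simp add: W_iff)
      ultimately show "v \<in> W n" by (auto simp: W_iff algebra_simps)
    qed
    show "bounded (W 0)" unfolding W_def by (auto intro: bounded_subset[OF bounded_cball])
  qed
  then obtain u where u: "\<And>n. u \<in> W n" by blast
  have "l u \<le> 0"
  proof (rule ccontr)
    assume "\<not> l u \<le> 0"
    then obtain n where "1 / l u < real n" using reals_Archimedean2 by blast
    then have "1 < real n * l u" using \<open>\<not> l u \<le> 0\<close> by (simp add: field_simps)
    then show False using u[of n] by (simp add: W_iff)
  qed
  then have "l u = 0" using l(2)[of u] u[of 0] by (simp add: W_iff)
  then show False using m(2)[of u] u[of 0] by (simp add: W_iff)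
qed

end

section \<open>Radial and tangent cones\<close>

text \<open>For convex \<open>K\<close> one admissible step suffices, since the segment from
  \<open>u\<close> to \<open>u + t *\<^sub>R h\<close> contains all shorter ones.\<close>

lemma radial_cone_iff:
  assumes "convex K" "u \<in> K"
  shows "h \<in> radial_cone K u \<longleftrightarrow> (\<exists>t>0. u + t *\<^sub>R h \<in> K)"
proof
  assume "\<exists>t>0. u + t *\<^sub>R h \<in> K"
  then obtain t where t: "t > 0" "u + t *\<^sub>R h \<in> K" by blast
  have "u + s *\<^sub>R h \<in> K" if "s \<in> {0..t}" for s
  proof -
    have "(1 - s / t) *\<^sub>R u + (s / t) *\<^sub>R (u + t *\<^sub>R h) \<in> K"
      using assms t that by (intro convexD) auto
    then show ?thesis using t by (simp add: algebra_simps)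
  qed
  then show "h \<in> radial_cone K u" using t by (auto simp: radial_cone_def)
qed (auto simp: radial_cone_def)

lemma
  assumes K: "convex K" "u \<in> K"
  shows convex_radial_cone: "convex (radial_cone K u)"
    and cone_radial_cone: "cone (radial_cone K u)"
proof -
  show "convex (radial_cone K u)"
  proof (rule convexI)
    fix v w and s t :: real
    assume vw: "v \<in> radial_cone K u" "w \<in> radial_cone K u" and st: "0 \<le> s" "0 \<le> t" "s + t = 1"
    obtain p q where p: "p > 0" "\<forall>r\<in>{0..p}. u + r *\<^sub>R v \<in> K" and q: "q > 0" "\<forall>r\<in>{0..q}. u + r *\<^sub>R w \<in> K"
      using vw by (auto simp: radial_cone_def)
    define r where "r = min p q"
    have "s *\<^sub>R (u + r *\<^sub>R v) + t *\<^sub>R (u + r *\<^sub>R w) \<in> K"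
      using K st p q by (intro convexD) (auto simp: r_def)
    also have "s *\<^sub>R (u + r *\<^sub>R v) + t *\<^sub>R (u + r *\<^sub>R w) = (s + t) *\<^sub>R u + r *\<^sub>R (s *\<^sub>R v + t *\<^sub>R w)"
      by (simp add: algebra_simps)
    finally show "s *\<^sub>R v + t *\<^sub>R w \<in> radial_cone K u"
      using p(1) q(1) st by (auto simp: radial_cone_iff[OF K] r_def intro!: exI[of _ "min p q"])
  qed
  show "cone (radial_cone K u)"
    unfolding cone_def
  proof (intro ballI allI impI)
    fix v and r :: real assume v: "v \<in> radial_cone K u" and r: "0 \<le> r"
    obtain t where t: "t > 0" "u + t *\<^sub>R v \<in> K" using v by (auto simp: radial_cone_iff[OF K])
    show "r *\<^sub>R v \<in> radial_cone K u"
    proof (cases "r = 0")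
      case True
      then show ?thesis using K by (auto simp: radial_cone_iff[OF K] intro: exI[of _ 1])
    next
      case False
      then show ?thesis using r t by (auto simp: radial_cone_iff[OF K] intro!: exI[of _ "t / r"])
    qed
  qed
qed

lemma
  assumes "convex K" "u \<in> K"
  shows convex_tangent_cone: "convex (tangent_cone K u)"
    and cone_tangent_cone: "cone (tangent_cone K u)"
    and zero_in_tangent_cone: "0 \<in> tangent_cone K u"
proof -
  show "convex (tangent_cone K u)" "cone (tangent_cone K u)"
    unfolding tangent_cone_def
    using assms by (simp_all add: convex_closure cone_closure convex_radial_cone cone_radial_cone)
  have "0 \<in> radial_cone K u" using assms by (auto simp: radial_cone_iff intro: exI[of _ 1])
  then show "0 \<in> tangent_cone K u" unfolding tangent_cone_def using closure_subset by blast
qed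

lemma closed_tangent_cone: "closed (tangent_cone K u)"
  by (simp add: tangent_cone_def)

lemma radial_cone_subset_tangent_cone: "radial_cone K u \<subseteq> tangent_cone K u"
  by (simp add: tangent_cone_def closure_subset)

lemma closed_annihilator: "closed (annihilator g)"
  unfolding annihilator_def by (intro closed_Collect_eq continuous_intros)

lemma convex_annihilator: "convex (annihilator g)"
  by (auto simp: annihilator_def convex_def blinfun.add_right blinfun.scaleR_right)

text \<open>The map \<open>sup 0\<close> is only norm-to-weak continuous, so it cannot be applied twice in one limit.
  The negative part \<open>m\<close> of \<open>z\<close> is therefore first approximated in norm, by convexity, with elements
  \<open>x n\<close> for which \<open>- x n\<close> is radial; \<open>w n\<close> below is the minimum of \<open>m\<close> and \<open>x n\<close>.\<close>

lemma positive_cone_polyhedric: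
  fixes a :: "'a::{banach, ordered_real_vector, lattice} \<Rightarrow> 'a \<Rightarrow> real" and u :: 'a
  assumes "coercive_form a c"
    and sup_weak: "\<And>(v :: nat \<Rightarrow> 'a) w. v \<longlonglongrightarrow> w \<Longrightarrow> weakly_tendsto (\<lambda>n. sup 0 (v n)) (sup 0 w)"
    and u: "0 \<le> u" and l_pos: "\<And>v. 0 \<le> v \<Longrightarrow> blinfun_apply l v \<ge> 0" and lu: "blinfun_apply l u = 0"
  shows "tangent_cone {v. 0 \<le> v} u \<inter> annihilator l \<subseteq> closure (radial_cone {v. 0 \<le> v} u \<inter> annihilator l)"
proof
  interpret coercive_form a c by fact
  let ?K = "{v :: 'a. 0 \<le> v}"
  have K: "convex ?K" by (auto intro!: convexI add_nonneg_nonneg scaleR_nonneg_nonneg)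
  have R_iff: "h \<in> radial_cone ?K u \<longleftrightarrow> (\<exists>t>0. 0 \<le> u + t *\<^sub>R h)" for h
    using radial_cone_iff[OF K, of u h] u by simp
  have R: "convex (radial_cone ?K u)" using convex_radial_cone[OF K] u by simp
  fix z assume "z \<in> tangent_cone ?K u \<inter> annihilator l"
  then have z: "z \<in> closure (radial_cone ?K u)" and lz: "blinfun_apply l z = 0"
    by (auto simp: tangent_cone_def annihilator_def)
  obtain v where v: "\<And>n. v n \<in> radial_cone ?K u" and v_lim: "v \<longlonglongrightarrow> z"
    using z unfolding closure_sequential by blast
  define p where "p = sup 0 z"
  define m where "m = sup 0 (- z)"
  have z_eq: "z = p - m"
  proof (rule antisym)
    have "p \<le> z + m" unfolding p_def
      using add_left_mono[of "- z" m z] add_left_mono[of 0 m z] by (intro sup_least) (auto simp: m_def)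
    then show "p - m \<le> z" by (simp add: algebra_simps)
    have "m \<le> p - z" unfolding m_def
      by (intro sup_least) (auto simp: p_def)
    then show "z \<le> p - m" by (simp add: algebra_simps)
  qed
  \<comment> \<open>Members of \<open>D\<close> lie between 0 and a multiple of \<open>u\<close>; as
    \<open>l\<close> is positive and vanishes at \<open>u\<close>, it vanishes on
    \<open>D\<close>.\<close>
  define D where "D = ?K \<inter> uminus ` radial_cone ?K u"
  have D_iff: "x \<in> D \<longleftrightarrow> 0 \<le> x \<and> (\<exists>t>0. 0 \<le> u - t *\<^sub>R x)" for x
  proof -
    have "x \<in> uminus ` radial_cone ?K u \<longleftrightarrow> - x \<in> radial_cone ?K u" by force
    then show ?thesis by (simp add: D_def R_iff)
  qed
  have l_D: "blinfun_apply l x = 0" if x: "x \<in> D" for x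
  proof -
    obtain t where t: "0 \<le> x" "t > 0" "0 \<le> u - t *\<^sub>R x" using x unfolding D_iff by blast
    have "t * blinfun_apply l x \<le> 0"
      using l_pos[OF t(3)] lu by (simp add: blinfun.diff_right blinfun.scaleR_right)
    then show ?thesis using l_pos[OF t(1)] t(2) by (simp add: mult_le_0_iff)
  qed
  \<comment> \<open>Since \<open>0 \<le> u + t *\<^sub>R v n\<close>, the negative part of
    \<open>v n\<close> is dominated by \<open>inverse t *\<^sub>R u\<close> and hence lies in
    \<open>D\<close>; these negative parts converge weakly to \<open>m\<close>.\<close>
  have "m \<in> closure D"
  proof (rule weak_limit_in_closure)
    show "convex D" unfolding D_def using K R by (intro convex_Int convex_negations)
    show "weakly_tendsto (\<lambda>n. sup 0 (- v n)) m"
      unfolding m_def using v_lim by (intro sup_weak tendsto_minus)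
    show "sup 0 (- v n) \<in> D" for n
    proof -
      obtain t where t: "t > 0" "0 \<le> u + t *\<^sub>R v n" using v R_iff by blast
      have inv: "0 \<le> inverse t" using t by simp
      have "0 \<le> inverse t *\<^sub>R (u + t *\<^sub>R v n)" using t inv by (intro scaleR_nonneg_nonneg) auto
      also have "\<dots> = inverse t *\<^sub>R u - (- v n)" using t by (simp add: scaleR_add_right)
      finally have "- v n \<le> inverse t *\<^sub>R u" by (simp only: diff_ge_0_iff_ge)
      moreover have "0 \<le> inverse t *\<^sub>R u" using u inv by (intro scaleR_nonneg_nonneg)
      ultimately have "sup 0 (- v n) \<le> inverse t *\<^sub>R u" by simp
      from scaleR_left_mono[OF this, of t] have "t *\<^sub>R sup 0 (- v n) \<le> u" using t by simp
      then show ?thesis using t by (auto simp: D_iff)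
    qed
  qed
  then obtain x where x: "\<And>n. x n \<in> D" and x_lim: "x \<longlonglongrightarrow> m"
    unfolding closure_sequential by blast
  have lm: "blinfun_apply l m = 0"
  proof -
    have "closure D \<subseteq> annihilator l"
      by (rule closure_minimal[OF _ closed_annihilator]) (use l_D in \<open>auto simp: annihilator_def\<close>)
    then show ?thesis using \<open>m \<in> closure D\<close> by (auto simp: annihilator_def)
  qed
  have lp: "blinfun_apply l p = 0" using lz lm unfolding z_eq by (simp add: blinfun.diff_right)
  define w where "w n = m - sup 0 (m - x n)" for n
  have m0: "0 \<le> m" by (simp add: m_def)
  have p0: "0 \<le> p" by (simp add: p_def)
  \<comment> \<open>From \<open>0 \<le> w n\<close> and \<open>w n \<le> x n\<close> it follows that
    \<open>l\<close> vanishes at \<open>w n\<close> and that a small multiple of \<open>w n\<close>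
    can be subtracted from \<open>u\<close>.\<close>
  have "p - w n \<in> radial_cone ?K u \<inter> annihilator l" for n
  proof -
    obtain t where t: "0 \<le> x n" "t > 0" "0 \<le> u - t *\<^sub>R x n" using x[of n] unfolding D_iff by blast
    have w0: "0 \<le> w n"
    proof -
      have "sup 0 (m - x n) \<le> m" using m0 t(1) by (intro sup_least) auto
      then show ?thesis by (simp add: w_def)
    qed
    have wx: "w n \<le> x n"
    proof -
      have "m - x n \<le> sup 0 (m - x n)" by simp
      then show ?thesis unfolding w_def by (metis diff_le_eq le_diff_eq add.commute)
    qed
    have "t *\<^sub>R w n \<le> t *\<^sub>R x n" using wx t by (intro scaleR_left_mono) auto
    then have "0 \<le> u - t *\<^sub>R w n" using t(3) by (metis diff_ge_0_iff_ge order_trans)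
    moreover have "0 \<le> t *\<^sub>R p" using t p0 by (intro scaleR_nonneg_nonneg) auto
    ultimately have "0 \<le> (u - t *\<^sub>R w n) + t *\<^sub>R p" by (rule add_nonneg_nonneg)
    then have "0 \<le> u + t *\<^sub>R (p - w n)" by (simp add: algebra_simps)
    moreover have "blinfun_apply l (w n) = 0"
      using l_pos[OF w0] l_pos[of "x n - w n"] wx l_D[OF x[of n]] by (simp add: blinfun.diff_right)
    ultimately show ?thesis using t(2) lp by (auto simp: R_iff annihilator_def blinfun.diff_right)
  qed
  \<comment> \<open>Here \<open>sup 0\<close> is applied to \<open>m - x n\<close>, which tends to 0
    in norm, so a single weak limit is taken.\<close>
  moreover have "weakly_tendsto (\<lambda>n. p - w n) z"
  proof -
    have "(\<lambda>n. m - x n) \<longlonglongrightarrow> 0" using tendsto_diff[OF tendsto_const x_lim, of m] by simp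
    from sup_weak[OF this] have "weakly_tendsto (\<lambda>n. sup 0 (m - x n)) 0" by simp
    then have "(\<lambda>n. blinfun_apply g z + blinfun_apply g (sup 0 (m - x n))) \<longlonglongrightarrow> blinfun_apply g z + 0"
      for g :: "'a \<Rightarrow>\<^sub>L real"
      by (intro tendsto_add tendsto_const) (simp add: weakly_tendsto_def)
    then show ?thesis
      by (simp add: weakly_tendsto_def w_def z_eq blinfun.diff_right blinfun.add_right algebra_simps)
  qed
  ultimately show "z \<in> closure (radial_cone ?K u \<inter> annihilator l)"
    by (intro weak_limit_in_closure convex_Int R convex_annihilator)
qed

section \<open>Directional differentiability of the solution map\<close>

context coercive_form begin

text \<open>The difference quotient \<open>q s\<close> is radial but may leave the kernel of
  \<open>l\<close>. Polyhedricity supplies a direction \<open>w\<close> near \<open>d\<close>,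
  radial and annihilated by \<open>l\<close>, that can be tested in the perturbed problem.
  Conversely, an approximate multiplier controls the residual of \<open>d\<close> at
  \<open>q s\<close>, because \<open>l\<close> is of order \<open>s\<close> there.\<close>

lemma VI_solution_directional_derivative:
  fixes us :: "real \<Rightarrow> 'a" and g h l :: "'a \<Rightarrow>\<^sub>L real"
  assumes K: "convex K" and u: "u \<in> VI a K g"
    and l: "\<And>v. blinfun_apply l v = a u v - blinfun_apply g v"
    and poly: "tangent_cone K u \<inter> annihilator l \<subseteq> closure (radial_cone K u \<inter> annihilator l)"
    and d: "d \<in> VI a (tangent_cone K u \<inter> annihilator l) h"
    and k: "(k \<longlongrightarrow> h) (at_right 0)"
    and us: "\<forall>\<^sub>F s in at_right 0. us s \<in> VI a K (g + s *\<^sub>R k s)"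
  shows "((\<lambda>s. inverse s *\<^sub>R (us s - u)) \<longlongrightarrow> d) (at_right 0)"
proof -
  define R where "R = radial_cone K u"
  define T where "T = tangent_cone K u"
  have uK: "u \<in> K" using u by (simp add: VI_def)
  note R_iff = radial_cone_iff[OF K uK, folded R_def]
  have RT: "R \<subseteq> T" by (simp add: R_def T_def radial_cone_subset_tangent_cone)
  have T: "closed T" "convex T" "cone T" "0 \<in> T"
    unfolding T_def using K uK
    by (auto simp: closed_tangent_cone convex_tangent_cone cone_tangent_cone zero_in_tangent_cone)
  obtain M where M: "M > 0" "\<And>u v. norm (a u v) \<le> norm u * norm v * M" using pos_bounded by blast
  have l_R: "blinfun_apply l r \<ge> 0" if r: "r \<in> R" for r
  proof -
    obtain t where t: "t > 0" "u + t *\<^sub>R r \<in> K" using r R_iff by blast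
    have "a u (u - (u + t *\<^sub>R r)) \<le> blinfun_apply g (u - (u + t *\<^sub>R r))"
      using u t(2) by (auto simp: VI_def)
    then have "t * blinfun_apply l r \<ge> 0"
      by (simp add: l minus_right scaleR_right blinfun.minus_right blinfun.scaleR_right algebra_simps)
    then show ?thesis using t(1) by (simp add: zero_le_mult_iff)
  qed
  have l_T: "blinfun_apply l v \<ge> 0" if "v \<in> T" for v
  proof -
    have "closure R \<subseteq> {v. 0 \<le> blinfun_apply l v}"
      by (rule closure_minimal) (use l_R in \<open>auto intro!: closed_Collect_le continuous_intros\<close>)
    then show ?thesis using that by (auto simp: T_def tangent_cone_def R_def)
  qed
  have dT: "d \<in> T" "blinfun_apply l d = 0"
    and d_VI: "\<And>v. v \<in> T \<Longrightarrow> blinfun_apply l v = 0 \<Longrightarrow> a d (d - v) \<le> blinfun_apply h (d - v)"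
    using d by (auto simp: VI_def T_def annihilator_def)
  \<comment> \<open>The residual of the limit problem at \<open>d\<close>: nonnegative on the
    critical cone and at most 0 at \<open>d\<close> itself.\<close>
  define \<mu> where "\<mu> v = a d v - blinfun_apply h v" for v
  have mu_d: "\<mu> d \<le> 0" using d_VI[OF T(4)] by (simp add: \<mu>_def)
  have mu_bl: "bounded_linear \<mu>" unfolding \<mu>_def
    by (intro bounded_linear_sub bounded_linear_right blinfun.bounded_linear_right)
  have mu_nonneg: "\<mu> v \<ge> 0" if v: "v \<in> T" "blinfun_apply l v = 0" for v
  proof -
    have "d + v \<in> T" using T(2,3) dT v convex_cone[of T] by blast
    from d_VI[OF this] show ?thesis using dT v
      by (simp add: \<mu>_def blinfun.add_right minus_right blinfun.minus_right)
  qed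
  define q where "q s = inverse s *\<^sub>R (us s - u)" for s
  define L where "L = norm h + 1"
  have L: "L > 0" by (simp add: L_def add_nonneg_pos)
  define B where "B = L / c"
  have B: "B > 0" using L c_pos by (simp add: B_def)
  \<comment> \<open>Sum of the factors of \<open>\<eta>\<close> in the estimates 2 to 5 below;
    \<open>B\<close> will bound the difference quotients.\<close>
  define Z where "Z = M * B + L + (B + norm d) + 1 + B"
  have Z: "Z > 0" unfolding Z_def using M B L by (intro add_pos_pos add_pos_nonneg mult_pos_pos) auto
  have k_close: "\<forall>\<^sub>F s in at_right 0. norm (k s - h) < e" if "e > 0" for e
    using tendstoD[OF k that] by (simp add: dist_norm)
  have k_L: "\<forall>\<^sub>F s in at_right 0. norm (k s) \<le> L"
    using k_close[OF zero_less_one]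
  proof eventually_elim
    case (elim s)
    then show ?case unfolding L_def using norm_triangle_sub[of "k s" h] by simp
  qed
  have pos: "\<forall>\<^sub>F s in at_right (0::real). 0 < s" by (rule eventually_at_right_less)
  have lim: "\<forall>\<^sub>F s in at_right 0. norm (q s - d) < e" if e: "e > 0" for e
  proof -
    define \<eta> where "\<eta> = c * e\<^sup>2 / (2 * Z)"
    have eta: "\<eta> > 0" using c_pos Z e by (simp add: \<eta>_def)
    have etaZ: "\<eta> * Z < c * e\<^sup>2" using c_pos Z e by (simp add: \<eta>_def)
    have "d \<in> closure (R \<inter> annihilator l)" using poly dT by (auto simp: T_def R_def annihilator_def)
    then obtain w where w: "w \<in> R" "blinfun_apply l w = 0" "norm (w - d) < \<eta>"
      using eta unfolding closure_approachable by (auto simp: annihilator_def dist_norm)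
    obtain t where t: "t > 0" "\<And>s. s \<in> {0..t} \<Longrightarrow> u + s *\<^sub>R w \<in> K"
      using w(1) by (auto simp: R_def radial_cone_def)
    obtain r where r: "r \<ge> 0" "\<And>v. v \<in> T \<Longrightarrow> \<mu> v + r * blinfun_apply l v \<ge> - \<eta> * norm v"
      using approximate_multiplier[OF T(1-3) blinfun.bounded_linear_right l_T mu_bl mu_nonneg eta] by blast
    have t_ev: "\<forall>\<^sub>F s in at_right 0. s < t"
      using eventually_at_right_real[OF t(1)] by eventually_elim simp
    \<comment> \<open>The multiplier \<open>r\<close> depends on \<open>\<eta>\<close> but is fixed
      before \<open>s\<close>, so this product becomes small.\<close>
    have "((\<lambda>s. r * s * L * B) \<longlongrightarrow> 0) (at_right 0)"
      by (auto intro!: tendsto_eq_intros)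
    then have r_ev: "\<forall>\<^sub>F s in at_right 0. r * s * L * B < \<eta>"
      using eta by (rule order_tendstoD)
    show ?thesis
      using pos us k_L k_close[OF eta] t_ev r_ev
    proof eventually_elim
      case (elim s)
      note s = \<open>0 < s\<close>
      have usq: "us s = u + s *\<^sub>R q s" using s by (simp add: q_def)
      have usK: "us s \<in> K" using elim by (simp add: VI_def)
      have qR: "q s \<in> R" using usK s unfolding usq R_iff by blast
      \<comment> \<open>The perturbed inequality, tested with \<open>u + s *\<^sub>R v\<close> and
        divided by \<open>s\<close>.\<close>
      have key: "blinfun_apply l (q s - v) + s * (a (q s) (q s - v) - blinfun_apply (k s) (q s - v)) \<le> 0"
        if "u + s *\<^sub>R v \<in> K" for v
      proof -
        define z where "z = q s - v"
        have eq: "us s - (u + s *\<^sub>R v) = s *\<^sub>R z" by (simp add: usq z_def algebra_simps)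
        have "a (us s) (us s - (u + s *\<^sub>R v)) \<le> blinfun_apply (g + s *\<^sub>R k s) (us s - (u + s *\<^sub>R v))"
          using elim(2) that by (auto simp: VI_def)
        then have "s * (blinfun_apply l z + s * (a (q s) z - blinfun_apply (k s) z)) \<le> 0"
          unfolding eq unfolding usq
          by (simp add: l add_left scaleR_left scaleR_right blinfun.add_left blinfun.scaleR_left
              blinfun.scaleR_right algebra_simps)
        then show ?thesis using s by (simp add: mult_le_0_iff z_def)
      qed
      have lq: "blinfun_apply l (q s) \<ge> 0" using l_R qR .
      have k_app: "\<bar>blinfun_apply (k s) v\<bar> \<le> L * norm v" for v
        using norm_blinfun[of "k s" v] elim(3) mult_right_mono[OF elim(3), of "norm v"] by simp
      \<comment> \<open>The test \<open>v = 0\<close> is used twice: positivity of \<open>l\<close>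
        at \<open>q s\<close> gives \<open>norm (q s) \<le> B\<close>, and nonnegativity of the form
        then bounds \<open>l\<close> at \<open>q s\<close> by \<open>s * (L * B)\<close>.\<close>
      have key0: "blinfun_apply l (q s) + s * (a (q s) (q s) - blinfun_apply (k s) (q s)) \<le> 0"
        using key[of 0] uK by simp
      have "s * (a (q s) (q s) - blinfun_apply (k s) (q s)) \<le> 0" using key0 lq by linarith
      then have "a (q s) (q s) \<le> blinfun_apply (k s) (q s)" using s by (simp add: mult_le_0_iff)
      then have "c * (norm (q s))\<^sup>2 \<le> L * norm (q s)"
        using coercive[of "q s"] k_app[of "q s"] by linarith
      then have "norm (q s) * (c * norm (q s)) \<le> norm (q s) * L" by (simp add: power2_eq_square mult_ac)
      then have qB: "norm (q s) \<le> B" using c_pos L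
        by (cases "q s = 0") (auto simp: B_def field_simps)
      have "s * (blinfun_apply (k s) (q s) - a (q s) (q s)) \<le> s * (L * B)"
      proof (intro mult_left_mono)
        have "L * norm (q s) \<le> L * B" using qB L by (intro mult_left_mono) auto
        then show "blinfun_apply (k s) (q s) - a (q s) (q s) \<le> L * B"
          using form_nonneg[of "q s"] k_app[of "q s"] by linarith
      qed (use s in simp)
      then have "blinfun_apply l (q s) \<le> s * (L * B)" using key0 by (simp add: algebra_simps)
      then have "r * blinfun_apply l (q s) \<le> r * (s * (L * B))" using r(1) by (rule mult_left_mono)
      then have rl: "r * blinfun_apply l (q s) \<le> \<eta>" using elim(6) by (simp add: mult_ac)
      have "\<eta> * norm (q s) \<le> \<eta> * B" using qB eta by (intro mult_left_mono) auto
      then have 4: "- \<mu> (q s) \<le> \<eta> + \<eta> * B" using r(2)[of "q s"] RT qR rl by auto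
      have "s * (a (q s) (q s - w) - blinfun_apply (k s) (q s - w)) \<le> 0"
        using key[of w] t(2)[of s] elim(5) s lq w(2) by (auto simp: blinfun.diff_right)
      then have 1: "a (q s) (q s - w) - blinfun_apply (k s) (q s - w) \<le> 0" using s by (simp add: mult_le_0_iff)
      have "a (q s) (w - d) \<le> norm (q s) * norm (w - d) * M" using M(2)[of "q s" "w - d"] by simp
      also have "\<dots> \<le> B * \<eta> * M" using qB w(3) M B eta by (intro mult_right_mono mult_mono) auto
      finally have 2: "a (q s) (w - d) \<le> B * \<eta> * M" .
      have "L * norm (w - d) \<le> L * \<eta>" using w(3) L by (intro mult_left_mono) auto
      then have 3: "- blinfun_apply (k s) (w - d) \<le> L * \<eta>" using k_app[of "w - d"] by linarith
      have "blinfun_apply (k s - h) (q s - d) \<le> norm (k s - h) * norm (q s - d)"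
        using norm_blinfun[of "k s - h" "q s - d"] by simp
      also have "\<dots> \<le> \<eta> * (B + norm d)"
        using elim(4) eta qB norm_triangle_ineq4[of "q s" d] by (intro mult_mono) auto
      finally have 5: "blinfun_apply (k s - h) (q s - d) \<le> \<eta> * (B + norm d)" .
      \<comment> \<open>The energy of the error is split so that the tested inequality, the distance
        from \<open>w\<close> to \<open>d\<close>, the convergence of \<open>k\<close> and the
        residual \<open>\<mu>\<close> appear separately.\<close>
      have "a (q s - d) (q s - d) = (a (q s) (q s - w) - blinfun_apply (k s) (q s - w))
          + (a (q s) (w - d) - blinfun_apply (k s) (w - d)) + blinfun_apply (k s - h) (q s - d) - \<mu> (q s) + \<mu> d"
        by (simp add: \<mu>_def diff_left diff_right blinfun.diff_left blinfun.diff_right)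
      also have "\<dots> \<le> \<eta> * Z"
        using 1 2 3 4 5 mu_d unfolding Z_def by (simp add: algebra_simps)
      finally have "c * (norm (q s - d))\<^sup>2 < c * e\<^sup>2" using coercive[of "q s - d"] etaZ by linarith
      then have "(norm (q s - d))\<^sup>2 < e\<^sup>2" using c_pos by simp
      then show ?case using e by (simp add: power2_less_imp_less)
    qed
  qed
  show ?thesis
    unfolding q_def[symmetric] by (rule tendstoI) (use lim in \<open>simp add: dist_norm\<close>)
qed

end

text \<open>The inequality for \<open>u\<close>, tested with \<open>inverse t *\<^sub>R v\<close>,
  is multiplied by \<open>t\<close> twice; for \<open>t = 0\<close> both sides vanish and 0 belongs
  to the cone.\<close>

lemma VI_cone_scaleR:
  assumes a: "bounded_bilinear a" and C: "cone C" "C \<noteq> {}"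
    and u: "u \<in> VI a C (blinfun_apply g)" and t: "t \<ge> 0"
  shows "t *\<^sub>R u \<in> VI a C (blinfun_apply (t *\<^sub>R g))"
proof (cases "t = 0")
  case True
  interpret bounded_bilinear a by (rule a)
  show ?thesis using True C by (simp add: VI_def zero_left cone_contains_0)
next
  case False
  interpret bounded_bilinear a by (rule a)
  have "a (t *\<^sub>R u) (t *\<^sub>R u - v) \<le> blinfun_apply (t *\<^sub>R g) (t *\<^sub>R u - v)" if v: "v \<in> C" for v
  proof -
    define x where "x = u - inverse t *\<^sub>R v"
    have "inverse t *\<^sub>R v \<in> C" using C(1) v t by (intro mem_cone) auto
    then have "a u x \<le> blinfun_apply g x" using u by (simp add: VI_def x_def)
    then have "t * (t * a u x) \<le> t * (t * blinfun_apply g x)" using t by (intro mult_left_mono)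
    moreover have "t *\<^sub>R u - v = t *\<^sub>R x" using False by (simp add: x_def scaleR_diff_right)
    ultimately show ?thesis by (simp add: scaleR_left scaleR_right blinfun.scaleR_left blinfun.scaleR_right)
  qed
  moreover have "t *\<^sub>R u \<in> C" using C(1) u t by (intro mem_cone) (auto simp: VI_def)
  ultimately show ?thesis by (simp add: VI_def)
qed

section \<open>The solution operator over a fixed convex set\<close>

context coercive_form begin

text \<open>For closed convex nonempty \<open>K\<close> there is exactly one solution, so the choice
  defines the solution operator.\<close>

definition VI_solution :: "'a set \<Rightarrow> ('a \<Rightarrow>\<^sub>L real) \<Rightarrow> 'a" where
  "VI_solution K g = (SOME u. u \<in> VI a K (blinfun_apply g))"

context
  fixes K :: "'a set"
  assumes K: "closed K" "convex K" "K \<noteq> {}"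
begin

lemma VI_solution_mem: "VI_solution K g \<in> VI a K (blinfun_apply g)"
proof -
  have "\<exists>u. u \<in> VI a K (blinfun_apply g)"
    using VI_exists[OF K blinfun.bounded_linear_right[of g]] by (simp add: ex_in_conv)
  then show ?thesis unfolding VI_solution_def by (rule someI_ex)
qed

lemma VI_solution_eqI: "u \<in> VI a K (blinfun_apply g) \<Longrightarrow> VI_solution K g = u"
  by (rule VI_unique[OF VI_solution_mem _ bounded_linear.linear[OF blinfun.bounded_linear_right]])

lemma VI_solution_lipschitz: "norm (VI_solution K g - VI_solution K g') \<le> norm (g - g') / c"
proof (rule VI_lipschitz[OF VI_solution_mem VI_solution_mem])
  show "blinfun_apply g v - blinfun_apply g' v \<le> norm (g - g') * norm v" for v
    using norm_blinfun[of "g - g'" v] by (simp add: blinfun.diff_left)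
qed (simp_all add: bounded_linear.linear[OF blinfun.bounded_linear_right])

end

end

section \<open>Quasi-variational inequalities\<close>

text \<open>Passing to \<open>p - z\<close> reflects the constraint set onto \<open>C\<close>. Only
  the set at \<open>z\<close> is described, so \<open>p\<close> may depend on \<open>z\<close>; this
  covers both the obstacle problem and the problem for the derivative.\<close>

lemma QVI_iff_reflected_VI:
  assumes "linear A" and Kz: "K z = (\<lambda>h. p - h) ` C"
  shows "z \<in> QVI A K F \<longleftrightarrow> p - z \<in> VI (\<lambda>u v. blinfun_apply (A u) v) C (blinfun_apply (A p - F))"
proof -
  have "z \<in> K z \<longleftrightarrow> p - z \<in> C" unfolding Kz
    using image_eqI[of z "\<lambda>h. p - h" "p - z" C] by auto
  moreover have "blinfun_apply (A z - F) (z - (p - h)) \<le> 0 \<longleftrightarrow>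
      blinfun_apply (A (p - z)) (p - z - h) \<le> blinfun_apply (A p - F) (p - z - h)" for h
  proof -
    define x where "x = p - z - h"
    have "z - (p - h) = - x" by (simp add: x_def)
    then show ?thesis unfolding x_def[symmetric]
      by (simp add: linear_diff[OF assms(1)] blinfun.diff_left blinfun.minus_right)
  qed
  ultimately show ?thesis unfolding QVI_def VI_def by (auto simp: Kz)
qed

lemma obstacle_set_eq_image:
  fixes \<Phi> :: "'a::ordered_ab_group_add \<Rightarrow> 'a"
  shows "obstacle_set \<Phi> w = (\<lambda>h. \<Phi> w - h) ` {v. 0 \<le> v}"
proof -
  have "v \<in> (\<lambda>h. \<Phi> w - h) ` {v. 0 \<le> v}" if "v \<le> \<Phi> w" for v
    using that by (intro image_eqI[of _ _ "\<Phi> w - v"]) auto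
  then show ?thesis by (auto simp: obstacle_set_def)
qed

lemma tangent_cone_obstacle_set:
  fixes \<Phi> :: "'a::{real_normed_vector, ordered_real_vector} \<Rightarrow> 'a"
  shows "tangent_cone (obstacle_set \<Phi> w) z = uminus ` tangent_cone {v. 0 \<le> v} (\<Phi> w - z)"
proof -
  have "h \<in> radial_cone (obstacle_set \<Phi> w) z \<longleftrightarrow> - h \<in> radial_cone {v. 0 \<le> v} (\<Phi> w - z)" for h
    by (simp add: radial_cone_def obstacle_set_def algebra_simps)
  then have "radial_cone (obstacle_set \<Phi> w) z = uminus ` radial_cone {v. 0 \<le> v} (\<Phi> w - z)"
    by force
  moreover have "closure (uminus ` X) = uminus ` closure X" for X :: "'a set"
  proof -
    have uminus_eq: "(uminus :: 'a \<Rightarrow> 'a) = (*\<^sub>R) (-1)" by (simp add: fun_eq_iff)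
    show ?thesis unfolding uminus_eq by (rule closure_scaleR[symmetric])
  qed
  ultimately show ?thesis unfolding tangent_cone_def by simp
qed

text \<open>Reflection turns the tangent cone of the obstacle set into that of the positive cone at
  \<open>\<Phi> y - y\<close>, while the annihilator is symmetric; hence the minus sign.\<close>

lemma critical_set_eq_image:
  fixes \<Phi> :: "'a::{real_normed_vector, ordered_real_vector} \<Rightarrow> 'a"
  shows "critical_set A \<Phi> \<Phi>' f y w =
    (\<lambda>h. \<Phi>' w - h) ` (tangent_cone {v. 0 \<le> v} (\<Phi> y - y) \<inter> annihilator (f - A y))"
proof -
  have "uminus ` T \<inter> annihilator g = uminus ` (T \<inter> annihilator g)" for T :: "'a set" and g :: "'a \<Rightarrow>\<^sub>L real"
    by (auto simp: annihilator_def blinfun.minus_right)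
  then show ?thesis
    by (simp add: critical_set_def tangent_cone_obstacle_set image_image)
qed

text \<open>Difference quotients along fixed directions obey the bound with \<open>C\<close> once
  both arguments lie in the ball, and the bound passes to the limit.\<close>

lemma Hadamard_derivative_lipschitz:
  assumes H: "has_Hadamard_derivative F F' y" and F: "C-lipschitz_on (cball y \<epsilon>) F" and \<epsilon>: "\<epsilon> > 0"
  shows "C-lipschitz_on UNIV F'"
proof (rule lipschitz_onI)
  show "0 \<le> C" using F by (rule lipschitz_on_nonneg)
  fix h k
  let ?q = "\<lambda>h s. inverse s *\<^sub>R (F (y + s *\<^sub>R h) - F y)"
  have lim: "((\<lambda>s. ?q h s) \<longlongrightarrow> F' h) (at_right 0)" for h
    using H unfolding has_Hadamard_derivative_def by (auto intro: tendsto_const)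
  have near: "\<forall>\<^sub>F s in at_right 0. y + s *\<^sub>R h \<in> cball y \<epsilon>" for h
  proof -
    have "((\<lambda>s. norm (s *\<^sub>R h)) \<longlongrightarrow> 0) (at_right 0)" by (auto intro!: tendsto_eq_intros)
    from order_tendstoD(2)[OF this \<epsilon>] show ?thesis
      by eventually_elim (simp add: dist_norm)
  qed
  have "((\<lambda>s. dist (?q h s) (?q k s)) \<longlongrightarrow> dist (F' h) (F' k)) (at_right 0)"
    by (intro tendsto_dist lim)
  moreover have "\<forall>\<^sub>F s in at_right 0. dist (?q h s) (?q k s) \<le> C * dist h k"
    using near[of h] near[of k] eventually_at_right_less[of 0]
  proof eventually_elim
    case (elim s)
    have "?q h s - ?q k s = inverse s *\<^sub>R (F (y + s *\<^sub>R h) - F (y + s *\<^sub>R k))"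
      by (simp add: scaleR_diff_right)
    then have "dist (?q h s) (?q k s) = inverse s * dist (F (y + s *\<^sub>R h)) (F (y + s *\<^sub>R k))"
      using elim(3) by (simp add: dist_norm)
    also have "\<dots> \<le> inverse s * (C * dist (y + s *\<^sub>R h) (y + s *\<^sub>R k))"
      using elim by (intro mult_left_mono lipschitz_onD[OF F]) auto
    also have "dist (y + s *\<^sub>R h) (y + s *\<^sub>R k) = s * dist h k"
      using elim(3) by (simp add: dist_norm flip: scaleR_diff_right)
    also have "inverse s * (C * (s * dist h k)) = C * dist h k" using elim(3) by simp
    finally show ?case .
  qed
  ultimately show "dist (F' h) (F' k) \<le> C * dist h k"
    by (rule tendsto_upperbound) simp
qed

text \<open>Substituting \<open>t * s\<close> for \<open>s\<close> in the difference quotient; for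
  \<open>t = 0\<close> the quotient in direction 0 is constantly 0.\<close>

lemma Hadamard_derivative_scaleR:
  assumes H: "has_Hadamard_derivative F F' y" and t: "t \<ge> 0"
  shows "F' (t *\<^sub>R h) = t *\<^sub>R F' h"
proof -
  let ?q = "\<lambda>h s. inverse s *\<^sub>R (F (y + s *\<^sub>R h) - F y)"
  have lim: "((\<lambda>s. ?q h s) \<longlongrightarrow> F' h) (at_right 0)" for h
    using H unfolding has_Hadamard_derivative_def by (auto intro: tendsto_const)
  show ?thesis
  proof (cases "t = 0")
    case True
    have "F' 0 = 0" using lim[of 0] by (simp add: tendsto_const_iff)
    then show ?thesis using True by simp
  next
    case False
    then have "filterlim (\<lambda>s. t * s) (at_right 0) (at_right 0)"
      using filtermap_times_pos_at_right[of t "0::real"] t by (simp add: filterlim_def)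
    from filterlim_compose[OF lim this]
    have "((\<lambda>s. t *\<^sub>R ?q h (t * s)) \<longlongrightarrow> t *\<^sub>R F' h) (at_right 0)" by (intro tendsto_scaleR tendsto_const)
    moreover have "t *\<^sub>R ?q h (t * s) = ?q (t *\<^sub>R h) s" for s
      using False by (simp add: mult.commute)
    ultimately have "((\<lambda>s. ?q (t *\<^sub>R h) s) \<longlongrightarrow> t *\<^sub>R F' h) (at_right 0)" by simp
    with lim[of "t *\<^sub>R h"] show ?thesis by (intro tendsto_unique[of "at_right (0::real)"]) simp_all
  qed
qed

theorem theorem3p2:
  fixes Vplus :: "'a::{banach, ordered_real_vector, lattice} set"
    and A :: "'a \<Rightarrow> ('a \<Rightarrow>\<^sub>L real)"
    and \<Phi> \<Phi>' :: "'a \<Rightarrow> 'a"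
    and f :: "'a \<Rightarrow>\<^sub>L real"
    and y :: 'a
    and C\<^sub>a C\<^sub>b C\<^sub>\<Phi> \<epsilon> R :: real
  assumes "reflexive_space TYPE('a)"
    and "closed Vplus" "convex Vplus" "cone Vplus" "Vplus \<inter> uminus ` Vplus = {0}"
    and "\<forall>u v. u \<le> v \<longleftrightarrow> v - u \<in> Vplus"
    and "\<forall>(u :: nat \<Rightarrow> 'a) v. u \<longlonglongrightarrow> v \<longrightarrow> weakly_tendsto (\<lambda>n. sup 0 (u n)) (sup 0 v)"
    and "linear A" "C\<^sub>a > 0" "C\<^sub>b > 0"
    and "\<forall>u v. blinfun_apply (A u) v \<le> C\<^sub>b * norm u * norm v"
    and "\<forall>u. blinfun_apply (A u) u \<ge> C\<^sub>a * (norm u)\<^sup>2"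
    and "\<forall>u. blinfun_apply (A (sup 0 u)) (sup 0 u - u) \<le> 0"
    and "y \<in> QVI A (obstacle_set \<Phi>) f"
    and "\<epsilon> > 0" "C\<^sub>\<Phi>-lipschitz_on (cball y \<epsilon>) \<Phi>" "C\<^sub>\<Phi> < C\<^sub>a / (C\<^sub>a + C\<^sub>b)"
    and "has_Hadamard_derivative \<Phi> \<Phi>' y"
    and "0 < R" "R \<le> \<epsilon>"
  shows "\<exists>\<alpha> :: ('a \<Rightarrow>\<^sub>L real) \<Rightarrow> 'a.
    (\<forall>d. (\<exists>ys :: real \<Rightarrow> 'a.
            (\<forall>\<^sub>F s in at_right 0. ys s \<in> QVI A (obstacle_set \<Phi>) (f + s *\<^sub>R d) \<inter> cball y R) \<and>
            ((\<lambda>s. inverse s *\<^sub>R (ys s - (y + s *\<^sub>R \<alpha> d))) \<longlongrightarrow> 0) (at_right 0)) \<and>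
         \<alpha> d \<in> QVI A (critical_set A \<Phi> \<Phi>' f y) d) \<and>
    (\<forall>d. \<forall>t\<ge>0. \<alpha> (t *\<^sub>R d) = t *\<^sub>R \<alpha> d)"
proof -

  \<comment> \<open>The coercive form and the positive cone\<close>
  define K :: "'a set" where "K = {v. 0 \<le> v}"
  define a where "a u v = blinfun_apply (A u) v" for u v
  have A_lin: "linear A" and Ca: "C\<^sub>a > 0" and Cb: "C\<^sub>b > 0" by fact+
  \<comment> \<open>Replacing \<open>v\<close> by \<open>- v\<close> makes the upper bound
    two-sided.\<close>
  have a_bound: "\<bar>a u v\<bar> \<le> C\<^sub>b * norm u * norm v" for u v
    using assms(11)[rule_format, of u v] assms(11)[rule_format, of u "- v"]
    by (auto simp: a_def blinfun.minus_right)
  have A_bound: "norm (A u) \<le> C\<^sub>b * norm u" for u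
    using a_bound[of u] Cb by (intro norm_blinfun_bound) (auto simp: a_def)
  then have A_bl: "bounded_linear A"
    using A_lin by (auto simp: bounded_linear_def bounded_linear_axioms_def mult.commute)
  interpret coercive_form a C\<^sub>a
  proof
    show "a (u + u') v = a u v + a u' v" "a u (v + v') = a u v + a u v'"
      "a (r *\<^sub>R u) v = r *\<^sub>R a u v" "a u (r *\<^sub>R v) = r *\<^sub>R a u v" for u u' v v' r
      by (simp_all add: a_def linear_add[OF A_lin] linear_scale[OF A_lin] blinfun.add_left
          blinfun.add_right blinfun.scaleR_left blinfun.scaleR_right)
    show "\<exists>M. \<forall>u v. norm (a u v) \<le> norm u * norm v * M"
      using a_bound by (intro exI[of _ C\<^sub>b]) (simp add: mult_ac)
    show "C\<^sub>a > 0" "a v v \<ge> C\<^sub>a * (norm v)\<^sup>2" for v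
      using Ca assms(12) by (simp_all add: a_def)
  qed
  have K_Vplus: "K = Vplus" using assms(6) by (auto simp: K_def)
  have K: "closed K" "convex K" "K \<noteq> {}"
    using assms(2,3) by (auto simp: K_Vplus[symmetric], auto simp: K_def)

  \<comment> \<open>Fixed-point form of the quasi-variational inequality\<close>
  define S where "S F w = \<Phi> w - VI_solution K (A (\<Phi> w) - F)" for F w
  have QVI_iff: "z \<in> QVI A (obstacle_set \<Phi>) F \<longleftrightarrow> S F z = z" for z F
  proof -
    have "z \<in> QVI A (obstacle_set \<Phi>) F \<longleftrightarrow> \<Phi> z - z \<in> VI a K (blinfun_apply (A (\<Phi> z) - F))"
      unfolding a_def K_def by (rule QVI_iff_reflected_VI[OF A_lin obstacle_set_eq_image])
    also have "\<dots> \<longleftrightarrow> VI_solution K (A (\<Phi> z) - F) = \<Phi> z - z"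
      using VI_solution_mem[OF K] VI_solution_eqI[OF K] by metis
    also have "\<dots> \<longleftrightarrow> S F z = z" by (auto simp: S_def algebra_simps)
    finally show ?thesis .
  qed

  \<comment> \<open>Critical cone and polyhedricity at the unperturbed solution\<close>
  define u where "u = \<Phi> y - y"
  have y_fix: "S f y = y" using assms(14) QVI_iff by blast
  then have u_sol: "u = VI_solution K (A (\<Phi> y) - f)" by (auto simp: u_def S_def algebra_simps)
  then have u_VI: "u \<in> VI a K (blinfun_apply (A (\<Phi> y) - f))" using VI_solution_mem[OF K] by simp
  have uK: "u \<in> K" using u_VI by (simp add: VI_def)
  \<comment> \<open>The multiplier \<open>f - A y\<close> of the obstacle problem is also the
    residual of the reflected inequality at \<open>u\<close>.\<close>
  define l where "l = f - A y"
  have l: "blinfun_apply l v = a u v - blinfun_apply (A (\<Phi> y) - f) v" for v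
    by (simp add: l_def a_def u_def linear_diff[OF A_lin] blinfun.diff_left)
  define T where "T = tangent_cone K u \<inter> annihilator l"
  have T: "closed T" "convex T" "T \<noteq> {}" and T_cone: "cone T"
  proof -
    have "cone (annihilator l)" by (auto simp: cone_def annihilator_def blinfun.scaleR_right)
    then show "cone T" unfolding T_def cone_def
      using cone_tangent_cone[OF K(2) uK] by (auto simp: cone_def)
    show "closed T" "convex T" unfolding T_def
      by (intro closed_Int closed_tangent_cone closed_annihilator convex_Int convex_annihilator
          convex_tangent_cone K uK)+
    have "0 \<in> T" using zero_in_tangent_cone[OF K(2) uK] by (simp add: T_def annihilator_def)
    then show "T \<noteq> {}" by blast
  qed
  have poly: "tangent_cone K u \<inter> annihilator l \<subseteq> closure (radial_cone K u \<inter> annihilator l)"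
    unfolding K_def
  proof (rule positive_cone_polyhedric[OF coercive_form_axioms])
    show "weakly_tendsto (\<lambda>n. sup 0 (v n)) (sup 0 w)" if "v \<longlonglongrightarrow> w"
      for v :: "nat \<Rightarrow> 'a" and w
      using assms(7) that by blast
    show "0 \<le> u" using uK by (simp add: K_def)
    \<comment> \<open>Testing with \<open>u + v\<close> gives positivity of \<open>l\<close>;
      testing with 0 gives the complementarity of \<open>l\<close> and \<open>u\<close>.\<close>
    have le: "a u (u - v) \<le> blinfun_apply (A (\<Phi> y) - f) (u - v)" if "v \<in> K" for v
      using u_VI that by (auto simp: VI_def)
    show nn: "0 \<le> blinfun_apply l v" if "0 \<le> v" for v
    proof -
      have "u + v \<in> K" using that uK by (simp add: K_def)
      from le[OF this] show ?thesis by (simp add: l minus_right blinfun.minus_right)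
    qed
    have "blinfun_apply l u \<le> 0" using le[of 0] by (simp add: l K_def)
    then show "blinfun_apply l u = 0" using nn[of u] uK by (simp add: K_def)
  qed

  \<comment> \<open>Contraction estimates\<close>
  define L where "L = 1 + C\<^sub>b / C\<^sub>a"
  have L: "L > 0" using Ca Cb by (simp add: L_def add_pos_pos)
  \<comment> \<open>The term \<open>p\<close> contributes the 1 in \<open>L\<close>, the solution
    operator the quotient \<open>C\<^sub>b / C\<^sub>a\<close>. The estimate is uniform in
    \<open>C\<close>, so it serves both the positive cone and \<open>T\<close>.\<close>
  have refl_lip: "norm ((p - VI_solution C (A p - F)) - (p' - VI_solution C (A p' - F')))
      \<le> L * norm (p - p') + norm (F - F') / C\<^sub>a"
    if C: "closed C" "convex C" "C \<noteq> {}" for C p p' F F'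
  proof -
    have "(A p - F) - (A p' - F') = A (p - p') - (F - F')" by (simp add: linear_diff[OF A_lin])
    then have "norm ((A p - F) - (A p' - F')) \<le> norm (A (p - p')) + norm (F - F')"
      by (metis norm_triangle_ineq4)
    also have "\<dots> \<le> C\<^sub>b * norm (p - p') + norm (F - F')" using A_bound by simp
    finally have "norm ((A p - F) - (A p' - F')) / C\<^sub>a \<le> (C\<^sub>b * norm (p - p') + norm (F - F')) / C\<^sub>a"
      using Ca by (simp add: divide_right_mono)
    with VI_solution_lipschitz[OF C, of "A p - F" "A p' - F'"]
    have "norm (VI_solution C (A p - F) - VI_solution C (A p' - F'))
        \<le> C\<^sub>b / C\<^sub>a * norm (p - p') + norm (F - F') / C\<^sub>a"
      by (simp add: add_divide_distrib)
    moreover have "norm ((p - VI_solution C (A p - F)) - (p' - VI_solution C (A p' - F')))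
        \<le> norm (p - p') + norm (VI_solution C (A p - F) - VI_solution C (A p' - F'))"
      using norm_triangle_ineq4[of "p - p'" "VI_solution C (A p - F) - VI_solution C (A p' - F')"]
      by (simp add: algebra_simps)
    ultimately show ?thesis by (simp add: L_def algebra_simps)
  qed
  \<comment> \<open>Since \<open>L = (C\<^sub>a + C\<^sub>b) / C\<^sub>a\<close>, the smallness
    assumption on \<open>C\<^sub>\<Phi>\<close> says precisely that
    \<open>\<kappa> < 1\<close>.\<close>
  define \<kappa> where "\<kappa> = L * C\<^sub>\<Phi>"
  have CPhi: "C\<^sub>\<Phi> \<ge> 0" using assms(16) by (rule lipschitz_on_nonneg)
  have kappa: "0 \<le> \<kappa>" "\<kappa> < 1"
  proof -
    show "0 \<le> \<kappa>" using L CPhi by (simp add: \<kappa>_def)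
    have "L = (C\<^sub>a + C\<^sub>b) / C\<^sub>a" using Ca by (simp add: L_def add_divide_distrib)
    then have eq: "\<kappa> = C\<^sub>\<Phi> * (C\<^sub>a + C\<^sub>b) / C\<^sub>a" by (simp add: \<kappa>_def)
    have "C\<^sub>\<Phi> * (C\<^sub>a + C\<^sub>b) < C\<^sub>a" using assms(17) Ca Cb by (simp only: pos_less_divide_eq add_pos_pos)
    then show "\<kappa> < 1" unfolding eq using Ca by simp
  qed
  have S_lip: "norm (S F w - S F' w') \<le> \<kappa> * norm (w - w') + norm (F - F') / C\<^sub>a"
    if "w \<in> cball y \<epsilon>" "w' \<in> cball y \<epsilon>" for w w' F F'
  proof -
    have "L * norm (\<Phi> w - \<Phi> w') \<le> L * (C\<^sub>\<Phi> * norm (w - w'))"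
      using lipschitz_onD[OF assms(16) that] L by (intro mult_left_mono) (auto simp: dist_norm)
    then show ?thesis using refl_lip[OF K, of "\<Phi> w" F "\<Phi> w'" F'] by (simp add: S_def \<kappa>_def mult.assoc)
  qed

  \<comment> \<open>The derivative as a fixed point, and its homogeneity\<close>
  define D where "D d w = \<Phi>' w - VI_solution T (A (\<Phi>' w) - d)" for d w
  have \<Phi>'_lip: "C\<^sub>\<Phi>-lipschitz_on UNIV \<Phi>'"
    by (rule Hadamard_derivative_lipschitz[OF assms(18,16,15)])
  \<comment> \<open>The derivative inherits the Lipschitz constant of \<open>\<Phi>\<close>, so
    \<open>D d\<close> contracts with the same factor as \<open>S\<close>, now on the whole
    space.\<close>
  have D_contr: "dist (D d w) (D d w') \<le> \<kappa> * dist w w'" for d w w'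
  proof -
    have "L * norm (\<Phi>' w - \<Phi>' w') \<le> L * (C\<^sub>\<Phi> * norm (w - w'))"
      using lipschitz_onD[OF \<Phi>'_lip, of w w'] L by (intro mult_left_mono) (auto simp: dist_norm)
    then show ?thesis using refl_lip[OF T, of "\<Phi>' w" d "\<Phi>' w'" d]
      by (simp add: D_def \<kappa>_def mult.assoc dist_norm)
  qed
  have D_ex1: "\<exists>!w. D d w = w" for d
    using D_contr kappa by (intro banach_fix_type) auto
  define \<alpha> where "\<alpha> d = (THE w. D d w = w)" for d
  have alpha_fix: "D d (\<alpha> d) = \<alpha> d" for d unfolding \<alpha>_def by (rule theI'[OF D_ex1])
  have alpha_eqI: "\<alpha> d = w" if "D d w = w" for d w using D_ex1 alpha_fix that by blast
  have alpha_QVI: "\<alpha> d \<in> QVI A (critical_set A \<Phi> \<Phi>' f y) d" for d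
  proof -
    have "\<Phi>' (\<alpha> d) - \<alpha> d = VI_solution T (A (\<Phi>' (\<alpha> d)) - d)"
      using alpha_fix[of d] by (simp add: D_def algebra_simps)
    then have "\<Phi>' (\<alpha> d) - \<alpha> d \<in> VI a T (blinfun_apply (A (\<Phi>' (\<alpha> d)) - d))"
      using VI_solution_mem[OF T] by simp
    then show ?thesis
      unfolding a_def T_def K_def l_def u_def
      by (rule QVI_iff_reflected_VI[OF A_lin critical_set_eq_image, THEN iffD2])
  qed
  \<comment> \<open>By uniqueness it suffices that \<open>t *\<^sub>R \<alpha> d\<close> is fixed:
    \<open>\<Phi>'\<close>, \<open>A\<close> and the solution operator over the cone
    \<open>T\<close> are all positively homogeneous.\<close>
  have alpha_hom: "\<alpha> (t *\<^sub>R d) = t *\<^sub>R \<alpha> d" if t: "t \<ge> 0" for t d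
  proof (rule alpha_eqI)
    have \<Phi>': "\<Phi>' (t *\<^sub>R \<alpha> d) = t *\<^sub>R \<Phi>' (\<alpha> d)" by (rule Hadamard_derivative_scaleR[OF assms(18) t])
    have "VI_solution T (t *\<^sub>R (A (\<Phi>' (\<alpha> d)) - d)) = t *\<^sub>R VI_solution T (A (\<Phi>' (\<alpha> d)) - d)"
      by (intro VI_solution_eqI[OF T] VI_cone_scaleR bounded_bilinear_axioms T_cone T t
          VI_solution_mem[OF T])
    then have "D (t *\<^sub>R d) (t *\<^sub>R \<alpha> d) = t *\<^sub>R D d (\<alpha> d)"
      by (simp add: D_def \<Phi>' linear_scale[OF A_lin] flip: scaleR_diff_right)
    then show "D (t *\<^sub>R d) (t *\<^sub>R \<alpha> d) = t *\<^sub>R \<alpha> d" by (simp add: alpha_fix)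
  qed

  \<comment> \<open>Perturbed solutions and their first-order expansion\<close>
  have expansion: "\<exists>ys :: real \<Rightarrow> 'a.
      (\<forall>\<^sub>F s in at_right 0. ys s \<in> QVI A (obstacle_set \<Phi>) (f + s *\<^sub>R d) \<inter> cball y R) \<and>
      ((\<lambda>s. inverse s *\<^sub>R (ys s - (y + s *\<^sub>R \<alpha> d))) \<longlongrightarrow> 0) (at_right 0)" for d
  proof -
    \<comment> \<open>The choice is meaningful for small \<open>s\<close>, where a fixed point in
      the ball exists; other values do not affect the limit.\<close>
    define ys where "ys s = (SOME z. z \<in> cball y R \<and> S (f + s *\<^sub>R d) z = z)" for s :: real
    have sub: "cball y R \<subseteq> cball y \<epsilon>" using assms(20) by auto
    have pos: "\<forall>\<^sub>F s in at_right (0::real). 0 < s" by (rule eventually_at_right_less)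
    \<comment> \<open>For small \<open>s\<close> the perturbation moves the centre \<open>y\<close>
      by less than \<open>(1 - \<kappa>) * R\<close>, so the ball is mapped into itself.\<close>
    have "((\<lambda>s. s * norm d / C\<^sub>a) \<longlongrightarrow> 0) (at_right 0)"
      using Ca by (auto intro!: tendsto_eq_intros)
    moreover have "0 < (1 - \<kappa>) * R" using kappa assms(19) by simp
    ultimately have "\<forall>\<^sub>F s in at_right 0. s * norm d / C\<^sub>a < (1 - \<kappa>) * R"
      by (rule order_tendstoD(2))
    with pos have ys: "\<forall>\<^sub>F s in at_right 0. ys s \<in> cball y R \<and> S (f + s *\<^sub>R d) (ys s) = ys s"
    proof eventually_elim
      case (elim s)
      have "\<exists>!z. z \<in> cball y R \<and> S (f + s *\<^sub>R d) z = z"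
      proof (rule Banach_fix[where c = \<kappa>])
        show "S (f + s *\<^sub>R d) ` cball y R \<subseteq> cball y R"
        proof safe
          fix z assume z: "z \<in> cball y R"
          have "norm (S (f + s *\<^sub>R d) z - S f y) \<le> \<kappa> * norm (z - y) + norm (f + s *\<^sub>R d - f) / C\<^sub>a"
            using z sub assms(15) by (intro S_lip) auto
          also have "\<dots> \<le> \<kappa> * R + (1 - \<kappa>) * R"
            using z kappa elim by (intro add_mono mult_left_mono) (auto simp: dist_norm norm_minus_commute)
          also have "\<dots> = R" by (simp add: algebra_simps)
          finally show "S (f + s *\<^sub>R d) z \<in> cball y R" by (simp add: y_fix dist_norm norm_minus_commute)
        qed
        show "dist (S (f + s *\<^sub>R d) z) (S (f + s *\<^sub>R d) z') \<le> \<kappa> * dist z z'"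
          if "z \<in> cball y R" "z' \<in> cball y R" for z z'
          using S_lip[OF subsetD[OF sub that(1)] subsetD[OF sub that(2)], of "f + s *\<^sub>R d" "f + s *\<^sub>R d"]
          by (simp add: dist_norm)
      qed (use kappa assms(19) in \<open>auto simp: complete_eq_closed\<close>)
      then show ?case unfolding ys_def by (rule ex1_implies_ex[THEN someI_ex])
    qed
    define w where "w s = y + s *\<^sub>R \<alpha> d" for s :: real
    define p where "p s = inverse s *\<^sub>R (\<Phi> (w s) - \<Phi> y)" for s
    define us where "us s = VI_solution K (A (\<Phi> (w s)) - (f + s *\<^sub>R d))" for s
    \<comment> \<open>The data at \<open>w s\<close> are
      \<open>A (\<Phi> y) - f + s *\<^sub>R k s\<close>, and \<open>k\<close> converges by Hadamard
      differentiability; this is the form required for differentiating the solution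
      operator.\<close>
    define k where "k s = A (p s) - d" for s
    have p_lim: "(p \<longlongrightarrow> \<Phi>' (\<alpha> d)) (at_right 0)"
      using assms(18) unfolding has_Hadamard_derivative_def p_def w_def by (auto intro: tendsto_const)
    have k_lim: "(k \<longlongrightarrow> A (\<Phi>' (\<alpha> d)) - d) (at_right 0)"
      unfolding k_def by (intro tendsto_diff tendsto_const bounded_linear.tendsto[OF A_bl] p_lim)
    have us_eq: "\<forall>\<^sub>F s in at_right 0. us s \<in> VI a K (blinfun_apply ((A (\<Phi> y) - f) + s *\<^sub>R k s))"
      using pos
    proof eventually_elim
      case (elim s)
      have "s *\<^sub>R k s = A (s *\<^sub>R p s) - s *\<^sub>R d" by (simp add: k_def scaleR_diff_right linear_scale[OF A_lin])
      also have "s *\<^sub>R p s = \<Phi> (w s) - \<Phi> y" using elim by (simp add: p_def)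
      finally have "(A (\<Phi> y) - f) + s *\<^sub>R k s = A (\<Phi> (w s)) - (f + s *\<^sub>R d)"
        by (simp add: linear_diff[OF A_lin])
      then show ?case unfolding us_def using VI_solution_mem[OF K] by metis
    qed
    have us_lim: "((\<lambda>s. inverse s *\<^sub>R (us s - u)) \<longlongrightarrow> VI_solution T (A (\<Phi>' (\<alpha> d)) - d)) (at_right 0)"
      by (rule VI_solution_directional_derivative[OF K(2) u_VI l poly _ k_lim us_eq])
        (use VI_solution_mem[OF T] in \<open>simp add: T_def\<close>)
    \<comment> \<open>The defect of the trial point \<open>w s\<close> in the fixed-point equation,
      divided by \<open>s\<close>; it tends to
      \<open>D d (\<alpha> d) - \<alpha> d = 0\<close>.\<close>
    define r where "r s = p s - inverse s *\<^sub>R (us s - u) - \<alpha> d" for s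
    have "(r \<longlongrightarrow> \<Phi>' (\<alpha> d) - VI_solution T (A (\<Phi>' (\<alpha> d)) - d) - \<alpha> d) (at_right 0)"
      unfolding r_def by (intro tendsto_diff p_lim us_lim tendsto_const)
    then have "(r \<longlongrightarrow> 0) (at_right 0)" using alpha_fix[of d] by (simp add: D_def)
    then have r_lim: "((\<lambda>s. norm (r s) / (1 - \<kappa>)) \<longlongrightarrow> 0) (at_right 0)"
      using kappa by (auto intro!: tendsto_eq_intros)
    have "((\<lambda>s. norm (s *\<^sub>R \<alpha> d)) \<longlongrightarrow> 0) (at_right 0)" by (rule tendsto_eq_intros | simp)+
    from order_tendstoD(2)[OF this \<open>\<epsilon> > 0\<close>]
    have w_ball: "\<forall>\<^sub>F s in at_right 0. w s \<in> cball y \<epsilon>"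
      by eventually_elim (simp add: w_def dist_norm)
    \<comment> \<open>For a contraction, the distance to the fixed point is at most the defect
      divided by \<open>1 - \<kappa>\<close>.\<close>
    have "\<forall>\<^sub>F s in at_right 0. norm (inverse s *\<^sub>R (ys s - w s)) \<le> norm (r s) / (1 - \<kappa>)"
      using pos ys w_ball
    proof eventually_elim
      case (elim s)
      have "S (f + s *\<^sub>R d) (w s) - w s = s *\<^sub>R r s"
      proof -
        have "s *\<^sub>R p s = \<Phi> (w s) - \<Phi> y" "s *\<^sub>R (inverse s *\<^sub>R (us s - u)) = us s - u"
          using elim(1) by (simp_all add: p_def)
        then have "s *\<^sub>R r s = \<Phi> (w s) - \<Phi> y - (us s - u) - s *\<^sub>R \<alpha> d"
          unfolding r_def by (simp only: scaleR_diff_right)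
        then show ?thesis by (simp add: S_def us_def u_def w_def)
      qed
      moreover have "norm (ys s - w s) \<le> norm (S (f + s *\<^sub>R d) (ys s) - S (f + s *\<^sub>R d) (w s))
          + norm (S (f + s *\<^sub>R d) (w s) - w s)"
        using norm_triangle_ineq[of "ys s - S (f + s *\<^sub>R d) (w s)" "S (f + s *\<^sub>R d) (w s) - w s"] elim(2)
        by simp
      moreover have "norm (S (f + s *\<^sub>R d) (ys s) - S (f + s *\<^sub>R d) (w s)) \<le> \<kappa> * norm (ys s - w s)"
        using S_lip[of "ys s" "w s" "f + s *\<^sub>R d" "f + s *\<^sub>R d"] elim sub by auto
      ultimately have "(1 - \<kappa>) * norm (ys s - w s) \<le> s * norm (r s)"
        using elim(1) by (simp add: algebra_simps)
      then have "norm (ys s - w s) / s \<le> norm (r s) / (1 - \<kappa>)"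
        using elim(1) kappa by (simp add: field_simps)
      moreover have "norm (inverse s *\<^sub>R (ys s - w s)) = norm (ys s - w s) / s"
        using elim(1) by (simp add: divide_inverse mult.commute)
      ultimately show ?case by simp
    qed
    from Lim_null_comparison[OF this r_lim]
    have "((\<lambda>s. inverse s *\<^sub>R (ys s - (y + s *\<^sub>R \<alpha> d))) \<longlongrightarrow> 0) (at_right 0)" by (simp add: w_def)
    moreover have "\<forall>\<^sub>F s in at_right 0. ys s \<in> QVI A (obstacle_set \<Phi>) (f + s *\<^sub>R d) \<inter> cball y R"
      using ys by eventually_elim (simp add: QVI_iff)
    ultimately show ?thesis by blast
  qed
  show ?thesis using expansion alpha_QVI alpha_hom by (intro exI[of _ \<alpha>]) blast
qed

end
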